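(* Let $a\in C^0(\mathbb T,\mathbb R)$ satisfy $0<a_-:=\inf_{\mathbb T} a<\sup_{\mathbb T} a=:a_+<\infty$, and let $\{H(x)\}_{x\in\mathbb T}$ be the associated family of divergence-gradient Jacobi operators driven by the doubling map, with almost-sure essential spectrum $\Sigma_{\rm ess}$. Then $\Sigma_{\rm ess}$ is an interval; more precisely there is a number $A>0$, depending only on $a$, such that $$[0,4a(0)]\subseteq \Sigma_{\rm ess}=[0,A]\subseteq[0,4a_+].$$
   Context: $\mathbb T=\mathbb R/\mathbb Z$ with Lebesgue probability measure. For $x\in\mathbb T$ and $n\in\mathbb Z_{\ge0}$ put $a_n(x)=a(2^n x \bmod 1)$. The operator $H(x)$ acts on $\ell^2(\mathbb Z_{\ge 0})$ by $$(H(x)u)_n=-a_{n+1}(x)u_{n+1}+(a_n(x)+a_{n+1}(x))u_n-a_n(x)u_{n-1},\quad n\ge0,$$ with Dirichlet boundary condition $u_{-1}=0$. By ergodicity of the doubling map $x\mapsto 2x \bmod 1$ there is a fixed set $\Sigma_{\rm ess}\subseteq\mathbb R$, depending only on $a$, such that $\sigma_{\rm ess}(H(x))=\Sigma_{\rm ess}$ for Lebesgue-a.e. $x\in\mathbb T$. *)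

theory Defs
  imports "HOL-Analysis.Analysis"
begin

section \<open>Bounded operators on the complex Hilbert space of square-summable sequences\<close>

text \<open>
  The sequence space is rendered as a carrier set, and an operator on it as a map on sequences,
  of which only the values on the carrier matter.
\<close>

definition l2 :: "(nat \<Rightarrow> complex) set" where
  "l2 = {u. summable (\<lambda>n. (cmod (u n))\<^sup>2)}"

definition l2_norm :: "(nat \<Rightarrow> complex) \<Rightarrow> real" where
  "l2_norm u = sqrt (\<Sum>n. (cmod (u n))\<^sup>2)"

definition shift_op ::
    "((nat \<Rightarrow> complex) \<Rightarrow> nat \<Rightarrow> complex) \<Rightarrow> complex \<Rightarrow> (nat \<Rightarrow> complex) \<Rightarrow> nat \<Rightarrow> complex" where
  "shift_op T z u = (\<lambda>n. T u n - z * u n)"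

text \<open>
  The second conjunct says that the inverse of \<open>T - z\<close> is bounded.
\<close>

definition resolvent_set :: "((nat \<Rightarrow> complex) \<Rightarrow> nat \<Rightarrow> complex) \<Rightarrow> complex set" where
  "resolvent_set T = {z. bij_betw (shift_op T z) l2 l2 \<and>
     (\<exists>C. \<forall>u\<in>l2. l2_norm u \<le> C * l2_norm (shift_op T z u))}"

definition spectrum :: "((nat \<Rightarrow> complex) \<Rightarrow> nat \<Rightarrow> complex) \<Rightarrow> complex set" where
  "spectrum T = - resolvent_set T"

definition eigenspace ::
    "((nat \<Rightarrow> complex) \<Rightarrow> nat \<Rightarrow> complex) \<Rightarrow> complex \<Rightarrow> (nat \<Rightarrow> complex) set" where
  "eigenspace T z = {u \<in> l2. \<forall>n. T u n = z * u n}"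

definition finite_dimensional :: "(nat \<Rightarrow> complex) set \<Rightarrow> bool" where
  "finite_dimensional E \<longleftrightarrow>
     (\<exists>B. finite B \<and> (\<forall>u\<in>E. \<exists>c. \<forall>n. u n = (\<Sum>b\<in>B. c b * b n)))"

text \<open>
  For a self-adjoint operator, the discrete spectrum consists of the eigenvalues of finite
  multiplicity that are isolated points of the spectrum, and the essential spectrum is the rest.
\<close>

definition discrete_spectrum :: "((nat \<Rightarrow> complex) \<Rightarrow> nat \<Rightarrow> complex) \<Rightarrow> complex set" where
  "discrete_spectrum T = {z. z isolated_in spectrum T \<and>
     (\<exists>u\<in>eigenspace T z. u \<noteq> (\<lambda>n. 0)) \<and> finite_dimensional (eigenspace T z)}"

definition ess_spectrum :: "((nat \<Rightarrow> complex) \<Rightarrow> nat \<Rightarrow> complex) \<Rightarrow> complex set" where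
  "ess_spectrum T = spectrum T - discrete_spectrum T"


section \<open>Divergence-gradient Jacobi operators over the doubling map\<close>

text \<open>
  A function on the circle \<open>\<real>/\<int>\<close> is a 1-periodic function on the reals; Lebesgue probability
  measure on the circle is Lebesgue measure on the fundamental domain \<open>[0,1)\<close>.
\<close>

definition circle_measure :: "real measure" where
  "circle_measure = restrict_space lborel {0..<1}"

definition doubling_coeff :: "(real \<Rightarrow> real) \<Rightarrow> real \<Rightarrow> nat \<Rightarrow> real" where
  "doubling_coeff a x n = a (frac (2 ^ n * x))"

definition jacobi_op :: "(real \<Rightarrow> real) \<Rightarrow> real \<Rightarrow> (nat \<Rightarrow> complex) \<Rightarrow> nat \<Rightarrow> complex" where
  "jacobi_op a x u n =
     - complex_of_real (doubling_coeff a x (n + 1)) * u (n + 1)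
     + complex_of_real (doubling_coeff a x n + doubling_coeff a x (n + 1)) * u n
     - complex_of_real (doubling_coeff a x n) * (if n = 0 then 0 else u (n - 1))"

text \<open>
  The description is meaningful only if the essential spectrum is almost surely constant; it then
  picks out the unique almost sure value, as the lemma below confirms.
\<close>

definition Sigma_ess :: "(real \<Rightarrow> real) \<Rightarrow> real set" where
  "Sigma_ess a =
     (THE S. AE x in circle_measure. ess_spectrum (jacobi_op a x) = complex_of_real ` S)"

lemma Sigma_ess_eqI:
  assumes "AE x in circle_measure. ess_spectrum (jacobi_op a x) = complex_of_real ` S"
  shows "Sigma_ess a = S"
  unfolding Sigma_ess_def
proof (rule the_equality)
  show "AE x in circle_measure. ess_spectrum (jacobi_op a x) = complex_of_real ` S"
    by (fact assms)
next
  fix S'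
  assume "AE x in circle_measure. ess_spectrum (jacobi_op a x) = complex_of_real ` S'"
  with assms have "AE x in circle_measure. complex_of_real ` S' = complex_of_real ` S"
    by eventually_elim simp
  moreover have "\<not> (AE x in circle_measure. False)"
    by (simp add: circle_measure_def eventually_False ae_filter_eq_bot_iff
        emeasure_restrict_space space_restrict_space)
  ultimately have "complex_of_real ` S' = complex_of_real ` S"
    by (cases "complex_of_real ` S' = complex_of_real ` S") auto
  then show "S' = S"
    by (simp add: inj_image_eq_iff inj_of_real)
qed

end

(*
  Let A be the supremum over all points y and all finitely supported unit vectors u of the quadratic
  form q_y(u) of H(y). Then 0 <= H(x) <= A for every x, so the spectrum lies in [0, A] always; we
  show that it fills [0, A] when the orbit of x is dense, which happens almost surely.

  Suppose H(x) - E is bounded below for some E in [0, A). By density the bound is uniform over all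
  base points, and it forces an exponential dichotomy for the transfer cocycle: through every y there
  is exactly one stable direction, which depends continuously on y. For E <= 4 a(0) plane waves at
  the fixed point y = 0 rule this out. For E > 4 a(0) the degree d of the stable direction, as a map
  from the circle to the projective line, satisfies d = 2 d because the cocycle covers the doubling
  map; hence d = 0 and the angle of the stable direction lifts to a bounded function on the circle.
  Every sign change of the stable solution lowers the integer part of this angle, so there are only
  finitely many, and the solution is eventually positive (after removing the alternating sign). A
  positive solution gives q <= E on the tail of the orbit, hence everywhere, so A <= E.
*)

theory Submission
  imports Defs
begin

section \<open>Square-summable sequences\<close>

text \<open>The doubling map is not invertible: an unstable direction at \<open>y\<close> would
  depend on a choice of past, whereas the stable direction depends on the forward orbit alone. It is
  therefore a function on the circle, and it has a degree. Decay rates never enter; the dichotomy is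
  used only through \<open>no_bump\<close>, combined with the fact that steps have determinant one.
  The fixed point 0 serves twice: up to energy \<open>4 * a 0\<close> it carries bounded waves, and
  above that its decaying solution fixes the constant in the recursion for the angle. The inclusion
  of the spectrum in [0, A] avoids the spectral theorem: norm bounds for \<open>H - w\<close> with
  \<open>Re w = A / 2\<close> confine the spectrum to discs that pass through 0 and A, and these
  discs meet exactly in [0, A]. At \<open>E = A\<close> a positive solution is no contradiction;
  that endpoint is reached by perturbing \<open>E\<close>.\<close>

lemma l2_bound_iff:
  "u \<in> l2 \<and> l2_norm u \<le> R \<longleftrightarrow> (\<forall>N. L2_set (\<lambda>n. cmod (u n)) {..<N} \<le> R)"
proof
  assume u: "u \<in> l2 \<and> l2_norm u \<le> R"
  show "\<forall>N. L2_set (\<lambda>n. cmod (u n)) {..<N} \<le> R"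
  proof
    fix N
    have "(\<Sum>n<N. (cmod (u n))\<^sup>2) \<le> (\<Sum>n. (cmod (u n))\<^sup>2)"
      using u by (intro sum_le_suminf) (auto simp: l2_def)
    then have "L2_set (\<lambda>n. cmod (u n)) {..<N} \<le> l2_norm u"
      by (simp add: L2_set_def l2_norm_def)
    with u show "L2_set (\<lambda>n. cmod (u n)) {..<N} \<le> R"
      by simp
  qed
next
  assume b: "\<forall>N. L2_set (\<lambda>n. cmod (u n)) {..<N} \<le> R"
  have R: "0 \<le> R"
    using b[rule_format, of 0] by simp
  have part: "(\<Sum>n<N. (cmod (u n))\<^sup>2) \<le> R\<^sup>2" for N
    using b[rule_format, of N] by (simp add: L2_set_def sqrt_le_D)
  have s: "summable (\<lambda>n. (cmod (u n))\<^sup>2)"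
    by (rule summableI_nonneg_bounded[OF _ part]) simp
  moreover have "(\<Sum>n. (cmod (u n))\<^sup>2) \<le> R\<^sup>2"
    by (rule suminf_le_const[OF s part])
  ultimately show "u \<in> l2 \<and> l2_norm u \<le> R"
    using R by (simp add: l2_def l2_norm_def real_le_lsqrt)
qed

lemma L2_set_le_l2_norm: "u \<in> l2 \<Longrightarrow> L2_set (\<lambda>n. cmod (u n)) {..<N} \<le> l2_norm u"
  using l2_bound_iff by blast

lemma cmod_le_l2_norm:
  assumes "u \<in> l2"
  shows "cmod (u n) \<le> l2_norm u"
proof -
  have "cmod (u n) \<le> L2_set (\<lambda>n. cmod (u n)) {..<Suc n}"
    by (rule member_le_L2_set) auto
  also have "\<dots> \<le> l2_norm u"
    by (rule L2_set_le_l2_norm[OF assms])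
  finally show ?thesis .
qed

lemma l2_norm_nonneg: "u \<in> l2 \<Longrightarrow> 0 \<le> l2_norm u"
  using cmod_le_l2_norm norm_ge_zero order_trans by blast

lemma l2_add:
  assumes "u \<in> l2" "v \<in> l2"
  shows "(\<lambda>n. u n + v n) \<in> l2 \<and> l2_norm (\<lambda>n. u n + v n) \<le> l2_norm u + l2_norm v"
  unfolding l2_bound_iff
proof
  fix N
  have "L2_set (\<lambda>n. cmod (u n + v n)) {..<N} \<le> L2_set (\<lambda>n. cmod (u n) + cmod (v n)) {..<N}"
    by (rule L2_set_mono) (auto simp: norm_triangle_ineq)
  also have "\<dots> \<le> L2_set (\<lambda>n. cmod (u n)) {..<N} + L2_set (\<lambda>n. cmod (v n)) {..<N}"
    by (rule L2_set_triangle_ineq)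
  also have "\<dots> \<le> l2_norm u + l2_norm v"
    using assms by (intro add_mono L2_set_le_l2_norm)
  finally show "L2_set (\<lambda>n. cmod (u n + v n)) {..<N} \<le> l2_norm u + l2_norm v" .
qed

lemma l2_scale:
  assumes "u \<in> l2"
  shows "(\<lambda>n. c * u n) \<in> l2 \<and> l2_norm (\<lambda>n. c * u n) \<le> cmod c * l2_norm u"
  unfolding l2_bound_iff
proof
  fix N
  have "L2_set (\<lambda>n. cmod (c * u n)) {..<N} = cmod c * L2_set (\<lambda>n. cmod (u n)) {..<N}"
    by (simp add: L2_set_right_distrib norm_mult)
  then show "L2_set (\<lambda>n. cmod (c * u n)) {..<N} \<le> cmod c * l2_norm u"
    using L2_set_le_l2_norm[OF assms] by (simp add: mult_left_mono)
qed

lemma l2_diff: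
  assumes "u \<in> l2" "v \<in> l2"
  shows "(\<lambda>n. u n - v n) \<in> l2 \<and> l2_norm (\<lambda>n. u n - v n) \<le> l2_norm u + l2_norm v"
  using l2_add[OF assms(1), of "\<lambda>n. - 1 * v n"] l2_scale[OF assms(2), of "- 1"] by simp

lemma l2_finite_support:
  assumes "\<And>n. n \<ge> N \<Longrightarrow> u n = 0"
  shows "u \<in> l2" "(l2_norm u)\<^sup>2 = (\<Sum>n<N. (cmod (u n))\<^sup>2)"
proof -
  have "(\<lambda>n. (cmod (u n))\<^sup>2) sums (\<Sum>n<N. (cmod (u n))\<^sup>2)"
    by (rule sums_finite) (use assms in \<open>auto simp: not_less\<close>)
  then show "u \<in> l2" "(l2_norm u)\<^sup>2 = (\<Sum>n<N. (cmod (u n))\<^sup>2)"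
    by (auto simp: l2_def l2_norm_def sums_iff sum_nonneg)
qed

lemma l2_norm_eq_0_iff:
  assumes "u \<in> l2"
  shows "l2_norm u \<le> 0 \<longleftrightarrow> u = (\<lambda>n. 0)"
proof
  assume "l2_norm u \<le> 0"
  then have "cmod (u n) \<le> 0" for n
    using cmod_le_l2_norm[OF assms, of n] by linarith
  then show "u = (\<lambda>n. 0)"
    by auto
qed (simp add: l2_norm_def)

text \<open>Banach's argument carried out coordinatewise instead of through completeness of
  \<open>l2\<close>: the Picard iterates stay in the invariant ball of radius \<open>R\<close>,
  their increments decay geometrically, and \<open>l2_bound_iff\<close> passes the norm bound to the
  coordinatewise limit.\<close>

lemma affine_contraction_fixpoint:
  fixes T :: "(nat \<Rightarrow> complex) \<Rightarrow> nat \<Rightarrow> complex"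
  assumes diff: "\<And>u v n. T (\<lambda>n. u n - v n) n = T u n - T v n"
    and lim: "\<And>u w n. (\<And>m. (\<lambda>k. u k m) \<longlonglongrightarrow> w m) \<Longrightarrow> (\<lambda>k. T (u k) n) \<longlonglongrightarrow> T w n"
    and contr: "\<And>u. u \<in> l2 \<Longrightarrow> T u \<in> l2 \<and> l2_norm (T u) \<le> q * l2_norm u"
    and q: "0 \<le> q" "q < 1" and f: "f \<in> l2"
  shows "\<exists>w\<in>l2. \<forall>n. w n = T w n + f n"
proof -
  define R where "R = l2_norm f / (1 - q)"
  define u where "u k = ((\<lambda>v n. T v n + f n) ^^ k) (\<lambda>n. 0)" for k
  have u_Suc: "u (Suc k) = (\<lambda>n. T (u k) n + f n)" for k
    by (simp add: u_def)
  have f0: "0 \<le> l2_norm f"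
    by (rule l2_norm_nonneg[OF f])
  have ub: "u k \<in> l2 \<and> l2_norm (u k) \<le> R" for k
  proof (induction k)
    case 0
    show ?case
      using f0 q by (simp add: u_def l2_def l2_norm_def R_def)
  next
    case (Suc k)
    have "l2_norm (u (Suc k)) \<le> q * l2_norm (u k) + l2_norm f" "u (Suc k) \<in> l2"
      using l2_add[of "T (u k)" f] contr[of "u k"] Suc f by (auto simp: u_Suc)
    moreover have "q * l2_norm (u k) \<le> q * R"
      using Suc q by (simp add: mult_left_mono)
    moreover have "q * R + l2_norm f = R"
      using q by (simp add: R_def field_simps)
    ultimately show ?case
      by simp
  qed
  have step: "(\<lambda>n. u (Suc k) n - u k n) \<in> l2 \<and>
      l2_norm (\<lambda>n. u (Suc k) n - u k n) \<le> q ^ k * l2_norm f" for k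
  proof (induction k)
    case 0
    have "T (\<lambda>n. 0) n = 0" for n
      using diff[of "\<lambda>n. 0" "\<lambda>n. 0" n] by simp
    then show ?case
      using f by (simp add: u_def)
  next
    case (Suc k)
    have "(\<lambda>n. u (Suc (Suc k)) n - u (Suc k) n) = T (\<lambda>n. u (Suc k) n - u k n)"
      by (rule ext) (simp add: u_Suc[of "Suc k"] u_Suc[of k] diff)
    moreover have "q * l2_norm (\<lambda>n. u (Suc k) n - u k n) \<le> q * (q ^ k * l2_norm f)"
      using Suc q by (simp add: mult_left_mono)
    ultimately show ?case
      using contr[of "\<lambda>n. u (Suc k) n - u k n"] Suc by (auto simp: mult.assoc)
  qed
  have "convergent (\<lambda>k. u k m)" for m
  proof -
    have "summable (\<lambda>k. u (Suc k) m - u k m)"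
    proof (rule summable_comparison_test')
      show "summable (\<lambda>k. q ^ k * l2_norm f)"
        using q by (intro summable_mult2 summable_geometric) auto
      show "norm (u (Suc k) m - u k m) \<le> q ^ k * l2_norm f" if "k \<ge> 0" for k
        using cmod_le_l2_norm[of "\<lambda>n. u (Suc k) n - u k n" m] step[of k] by auto
    qed
    then have "convergent (\<lambda>N. \<Sum>k<N. u (Suc k) m - u k m)"
      by (simp add: summable_iff_convergent)
    then show ?thesis
      using sum_lessThan_telescope[of "\<lambda>k. u k m"] by (simp add: u_def[of 0])
  qed
  then obtain w where w: "\<And>m. (\<lambda>k. u k m) \<longlonglongrightarrow> w m"
    unfolding convergent_def by metis
  have "w \<in> l2 \<and> l2_norm w \<le> R"
    unfolding l2_bound_iff
  proof
    fix N
    have "(\<lambda>k. L2_set (\<lambda>n. cmod (u k n)) {..<N}) \<longlonglongrightarrow> L2_set (\<lambda>n. cmod (w n)) {..<N}"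
      unfolding L2_set_def by (intro tendsto_intros w)
    then show "L2_set (\<lambda>n. cmod (w n)) {..<N} \<le> R"
      using ub l2_bound_iff by (intro LIMSEQ_le_const2) blast+
  qed
  moreover have "w n = T w n + f n" for n
  proof (rule LIMSEQ_unique)
    show "(\<lambda>k. u (Suc k) n) \<longlonglongrightarrow> w n"
      using w by (rule LIMSEQ_Suc)
    show "(\<lambda>k. u (Suc k) n) \<longlonglongrightarrow> T w n + f n"
      unfolding u_Suc by (intro tendsto_intros lim w)
  qed
  ultimately show ?thesis
    by blast
qed

text \<open>Neumann series: with \<open>d = z - w\<close>, the operator \<open>H - z\<close> is
  \<open>d * (T - 1)\<close> for \<open>T = (H - w) / d\<close>, whose norm is at most
  \<open>r / cmod d < 1\<close>.\<close>

lemma resolvent_set_outside_disc: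
  fixes H :: "(nat \<Rightarrow> complex) \<Rightarrow> nat \<Rightarrow> complex"
  assumes diff: "\<And>u v n. H (\<lambda>n. u n - v n) n = H u n - H v n"
    and lim: "\<And>u w n. (\<And>m. (\<lambda>k. u k m) \<longlonglongrightarrow> w m) \<Longrightarrow> (\<lambda>k. H (u k) n) \<longlonglongrightarrow> H w n"
    and disc: "\<And>u. u \<in> l2 \<Longrightarrow> shift_op H w u \<in> l2 \<and> l2_norm (shift_op H w u) \<le> r * l2_norm u"
    and r: "0 \<le> r" "r < cmod (z - w)"
  shows "z \<in> resolvent_set H"
proof -
  define d where "d = z - w"
  have d: "d \<noteq> 0" "0 < cmod d" "r < cmod d"
    using r by (auto simp: d_def)
  define T where "T u n = inverse d * shift_op H w u n" for u n
  have shift_T: "shift_op H z u n = d * (T u n - u n)" for u n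
    using d by (simp add: T_def shift_op_def d_def field_simps)
  have contr: "T u \<in> l2 \<and> l2_norm (T u) \<le> r / cmod d * l2_norm u" if "u \<in> l2" for u
  proof -
    have T: "T u = (\<lambda>n. inverse d * shift_op H w u n)"
      by (simp add: T_def fun_eq_iff)
    have "l2_norm (T u) \<le> cmod (inverse d) * l2_norm (shift_op H w u)" "T u \<in> l2"
      unfolding T using l2_scale[of "shift_op H w u" "inverse d"] disc[OF that] by auto
    moreover have "cmod (inverse d) * l2_norm (shift_op H w u)
        \<le> cmod (inverse d) * (r * l2_norm u)"
      using disc[OF that] by (intro mult_left_mono) auto
    moreover have "cmod (inverse d) * (r * l2_norm u) = r / cmod d * l2_norm u"
      by (simp add: norm_inverse divide_inverse algebra_simps)
    ultimately show ?thesis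
      by simp
  qed
  have q: "0 \<le> r / cmod d" "r / cmod d < 1"
    using d r by auto
  have T_diff: "T (\<lambda>n. u n - v n) n = T u n - T v n" for u v n
    by (simp add: T_def shift_op_def diff algebra_simps)
  have T_lim: "(\<lambda>k. T (u k) n) \<longlonglongrightarrow> T w n" if "\<And>m. (\<lambda>k. u k m) \<longlonglongrightarrow> w m" for u w n
    unfolding T_def shift_op_def by (intro tendsto_intros lim that)
  have mem: "shift_op H z u \<in> l2" if "u \<in> l2" for u
  proof -
    have "shift_op H z u = (\<lambda>n. d * (T u n - u n))"
      by (simp add: shift_T fun_eq_iff)
    then show ?thesis
      using l2_scale[of "\<lambda>n. T u n - u n" d] l2_diff[of "T u" u] contr[OF that] that by simp
  qed
  have below: "l2_norm u \<le> inverse (cmod d - r) * l2_norm (shift_op H z u)" if "u \<in> l2" for u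
  proof -
    define g where "g n = inverse d * shift_op H z u n" for n
    have g: "g \<in> l2 \<and> l2_norm g \<le> cmod (inverse d) * l2_norm (shift_op H z u)"
      unfolding g_def by (rule l2_scale[OF mem[OF that]])
    have "u = (\<lambda>n. T u n - g n)"
      using d(1) by (simp add: g_def shift_T fun_eq_iff flip: mult.assoc)
    then have "l2_norm u \<le> l2_norm (T u) + l2_norm g"
      using l2_diff[of "T u" g] contr[OF that] g by metis
    then have "l2_norm u \<le> r / cmod d * l2_norm u + l2_norm (shift_op H z u) / cmod d"
      using contr[OF that] g by (auto simp: norm_inverse divide_inverse algebra_simps)
    then have "(cmod d - r) * l2_norm u \<le> l2_norm (shift_op H z u)"
      using d by (simp add: field_simps)
    then show ?thesis
      using d by (simp add: field_simps)
  qed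
  have "inj_on (shift_op H z) l2"
  proof (rule inj_onI)
    fix u v assume uv: "u \<in> l2" "v \<in> l2" "shift_op H z u = shift_op H z v"
    have m: "(\<lambda>n. u n - v n) \<in> l2"
      using l2_diff uv by blast
    have "shift_op H z (\<lambda>n. u n - v n) = (\<lambda>n. shift_op H z u n - shift_op H z v n)"
      by (simp add: shift_op_def diff fun_eq_iff algebra_simps)
    then have "l2_norm (shift_op H z (\<lambda>n. u n - v n)) = 0"
      using uv by (simp add: l2_norm_def)
    then have "(\<lambda>n. u n - v n) = (\<lambda>n. 0)"
      using below[OF m] by (simp flip: l2_norm_eq_0_iff[OF m])
    then show "u = v"
      by (simp add: fun_eq_iff)
  qed
  moreover have "\<exists>u\<in>l2. shift_op H z u = g" if "g \<in> l2" for g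
  proof -
    have "(\<lambda>n. - inverse d * g n) \<in> l2"
      using l2_scale[OF that] by blast
    then obtain u where u: "u \<in> l2" "\<And>n. u n = T u n + - inverse d * g n"
      using affine_contraction_fixpoint[OF T_diff T_lim contr q] by blast
    have "shift_op H z u n = g n" for n
    proof -
      have "T u n - u n = inverse d * g n"
        using u(2)[of n] by (simp add: algebra_simps)
      then show ?thesis
        using d by (simp add: shift_T)
    qed
    then show ?thesis
      using u by blast
  qed
  ultimately have "bij_betw (shift_op H z) l2 l2"
    using mem by (force simp: bij_betw_def)
  then show ?thesis
    using below by (auto simp: resolvent_set_def)
qed

section \<open>Divergence-gradient Jacobi operators\<close>

definition prev :: "(nat \<Rightarrow> real) \<Rightarrow> nat \<Rightarrow> real" where
  "prev u n = (if n = 0 then 0 else u (n - 1))"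

definition jac :: "(nat \<Rightarrow> real) \<Rightarrow> (nat \<Rightarrow> real) \<Rightarrow> nat \<Rightarrow> real" where
  "jac b u n = b n * (u n - prev u n) - b (Suc n) * (u (Suc n) - u n)"

section \<open>Norm bounds derived from the quadratic form\<close>

lemma jac_by_parts:
  assumes "v L = 0"
  shows "(\<Sum>n<L. jac b u n * v n) = (\<Sum>n\<le>L. b n * (u n - prev u n) * (v n - prev v n))"
proof -
  have "(\<Sum>n<L. jac b u n * v n) =
      (\<Sum>n<L. b n * (u n - prev u n) * (v n - prev v n)) - b L * (u L - prev u L) * prev v L"
    by (induction L) (auto simp: jac_def prev_def algebra_simps)
  with assms show ?thesis
    by (simp add: lessThan_Suc_atMost[symmetric] algebra_simps)
qed

lemma jac_symmetric:
  assumes "u L = 0" "v L = 0"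
  shows "(\<Sum>n<L. jac b u n * v n) = (\<Sum>n<L. u n * jac b v n)"
  using jac_by_parts[of u L b v] jac_by_parts[of v L b u] assms
  by (simp add: mult.commute mult.left_commute)

text \<open>In operator terms, \<open>0 <= H <= A\<close> gives \<open>H^2 <= A * H\<close>, which
  is \<open>(H - A/2)^2 <= (A/2)^2\<close>. The first inequality comes from nonnegativity of the
  form \<open>q\<close> at \<open>u - H u / A\<close>, together with the upper bound for
  \<open>q\<close> at \<open>H u\<close>.\<close>

lemma jac_real_norm_bound:
  assumes b: "\<And>n. 0 \<le> b n" and A: "0 < A"
    and form: "\<And>L v. (\<And>n. n \<ge> L \<Longrightarrow> v n = 0) \<Longrightarrow>
        (\<Sum>n\<le>L. b n * (v n - prev v n)\<^sup>2) \<le> A * (\<Sum>n<L. (v n)\<^sup>2)"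
    and u: "\<And>n. n \<ge> N \<Longrightarrow> u n = 0"
  shows "(\<Sum>n<Suc N. (jac b u n - A / 2 * u n)\<^sup>2) \<le> (A / 2)\<^sup>2 * (\<Sum>n<N. (u n)\<^sup>2)"
proof -
  \<comment> \<open>\<open>jac b u\<close> may be nonzero one site beyond the support of
    \<open>u\<close>.\<close>
  define L where "L = Suc N"
  define g where "g = jac b u"
  have uL: "u n = 0" if "n \<ge> L" for n
    using u that by (simp add: L_def)
  have gL: "g n = 0" if "n \<ge> L" for n
    using u that by (auto simp: g_def jac_def prev_def L_def)
  define q where "q = (\<Sum>n\<le>L. b n * (u n - prev u n) * (u n - prev u n))"
  define G where "G = (\<Sum>n<L. (g n)\<^sup>2)"
  have ug: "(\<Sum>n\<le>L. b n * (u n - prev u n) * (g n - prev g n)) = G"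
    using jac_by_parts[of g L b u] gL by (simp add: G_def power2_eq_square flip: g_def)
  have gu: "(\<Sum>n<L. g n * u n) = q"
    using jac_by_parts[of u L b u] uL by (simp add: q_def flip: g_def)
  have gg: "(\<Sum>n\<le>L. b n * (g n - prev g n)\<^sup>2) \<le> A * G"
    unfolding G_def by (rule form) (rule gL)
  define w where "w n = u n - g n / A" for n
  have wp: "w n - prev w n = (u n - prev u n) - (g n - prev g n) / A" for n
    by (simp add: w_def prev_def diff_divide_distrib)
  have "0 \<le> (\<Sum>n\<le>L. b n * (w n - prev w n)\<^sup>2)"
    using b by (intro sum_nonneg) simp
  also have "\<dots> = (\<Sum>n\<le>L. b n * (u n - prev u n) * (u n - prev u n)
      - 2 / A * (b n * (u n - prev u n) * (g n - prev g n)) + 1 / A\<^sup>2 * (b n * (g n - prev g n)\<^sup>2))"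
    unfolding wp using A by (intro sum.cong) (auto simp: power2_eq_square field_simps)
  also have "\<dots> = q - 2 / A * G + 1 / A\<^sup>2 * (\<Sum>n\<le>L. b n * (g n - prev g n)\<^sup>2)"
    unfolding q_def ug[symmetric] by (simp only: sum.distrib sum_subtractf sum_distrib_left)
  also have "\<dots> \<le> q - 2 / A * G + 1 / A\<^sup>2 * (A * G)"
    using gg by (intro add_left_mono mult_left_mono) auto
  also have "\<dots> = q - G / A"
    using A by (simp add: power2_eq_square field_simps)
  finally have Gq: "G \<le> A * q"
    using A by (simp add: field_simps)
  have "(\<Sum>n<L. (g n - A / 2 * u n)\<^sup>2)
      = (\<Sum>n<L. (g n)\<^sup>2 - A * (g n * u n) + (A / 2)\<^sup>2 * (u n)\<^sup>2)"
    by (intro sum.cong) (auto simp: power2_eq_square algebra_simps)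
  also have "\<dots> = G - A * q + (A / 2)\<^sup>2 * (\<Sum>n<L. (u n)\<^sup>2)"
    by (simp add: sum.distrib sum_subtractf G_def flip: sum_distrib_left gu)
  also have "\<dots> \<le> (A / 2)\<^sup>2 * (\<Sum>n<L. (u n)\<^sup>2)"
    using Gq by simp
  also have "(\<Sum>n<L. (u n)\<^sup>2) = (\<Sum>n<N. (u n)\<^sup>2)"
    using u by (simp add: L_def)
  finally show ?thesis
    by (simp add: g_def L_def)
qed

text \<open>By symmetry of \<open>jac\<close> the cross terms between \<open>(H - A/2) u\<close> and
  \<open>Im w\<close> times \<open>\<i> * u\<close> cancel, so the real bound \<open>(A/2)^2\<close>
  just gains the summand \<open>(Im w)^2\<close>.\<close>

lemma jac_complex_norm_bound:
  fixes u :: "nat \<Rightarrow> complex"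
  assumes b: "\<And>n. 0 \<le> b n" and A: "0 < A"
    and form: "\<And>L v. (\<And>n. n \<ge> L \<Longrightarrow> v n = 0) \<Longrightarrow>
        (\<Sum>n\<le>L. b n * (v n - prev v n)\<^sup>2) \<le> A * (\<Sum>n<L. (v n)\<^sup>2)"
    and u: "\<And>n. n \<ge> N \<Longrightarrow> u n = 0" and w: "Re w = A / 2"
  shows "(\<Sum>n<Suc N. (cmod (Complex (jac b (\<lambda>n. Re (u n)) n) (jac b (\<lambda>n. Im (u n)) n) - w * u n))\<^sup>2)
      \<le> (cmod w)\<^sup>2 * (\<Sum>n<N. (cmod (u n))\<^sup>2)"
proof -
  define p where "p n = Re (u n)" for n
  define r where "r n = Im (u n)" for n
  have p0: "p n = 0" and r0: "r n = 0" if "n \<ge> N" for n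
    using u[OF that] by (simp_all add: p_def r_def)
  define P where "P n = jac b p n - A / 2 * p n" for n
  define R where "R n = jac b r n - A / 2 * r n" for n
  define s where "s = Im w"
  have "(cmod (Complex (jac b p n) (jac b r n) - w * u n))\<^sup>2
      = (P n)\<^sup>2 + (R n)\<^sup>2 + s\<^sup>2 * (cmod (u n))\<^sup>2 + 2 * s * (jac b p n * r n - p n * jac b r n)" for n
    by (simp add: cmod_power2 w P_def R_def s_def flip: p_def r_def)
       (simp add: power2_eq_square algebra_simps)
  then have "(\<Sum>n<Suc N. (cmod (Complex (jac b p n) (jac b r n) - w * u n))\<^sup>2)
      = (\<Sum>n<Suc N. (P n)\<^sup>2) + (\<Sum>n<Suc N. (R n)\<^sup>2) + s\<^sup>2 * (\<Sum>n<Suc N. (cmod (u n))\<^sup>2)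
        + 2 * s * ((\<Sum>n<Suc N. jac b p n * r n) - (\<Sum>n<Suc N. p n * jac b r n))"
    by (simp only: sum.distrib flip: sum_subtractf sum_distrib_left)
  also have "(\<Sum>n<Suc N. jac b p n * r n) = (\<Sum>n<Suc N. p n * jac b r n)"
    by (rule jac_symmetric) (simp_all add: p0 r0)
  also have "(\<Sum>n<Suc N. (cmod (u n))\<^sup>2) = (\<Sum>n<N. (cmod (u n))\<^sup>2)"
    by (simp add: u)
  also have "(\<Sum>n<Suc N. (P n)\<^sup>2) + (\<Sum>n<Suc N. (R n)\<^sup>2)
      \<le> (A / 2)\<^sup>2 * (\<Sum>n<N. (p n)\<^sup>2) + (A / 2)\<^sup>2 * (\<Sum>n<N. (r n)\<^sup>2)"
    unfolding P_def R_def
    by (intro add_mono jac_real_norm_bound[OF b A form]) (simp_all add: p0 r0)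
  also have "\<dots> = (A / 2)\<^sup>2 * (\<Sum>n<N. (cmod (u n))\<^sup>2)"
    by (simp add: cmod_power2 sum.distrib distrib_left p_def r_def)
  finally show ?thesis
    by (simp add: cmod_power2[of w] w s_def algebra_simps p_def r_def)
qed

lemma jacobi_op_eq_jac:
  "jacobi_op a x u n = Complex (jac (doubling_coeff a x) (\<lambda>n. Re (u n)) n)
     (jac (doubling_coeff a x) (\<lambda>n. Im (u n)) n)"
  by (simp add: jacobi_op_def jac_def prev_def complex_eq_iff algebra_simps)

lemma jacobi_op_resolvent_set:
  assumes b: "\<And>n. 0 \<le> doubling_coeff a x n" and A: "0 < A"
    and form: "\<And>L v. (\<And>n. n \<ge> L \<Longrightarrow> v n = 0) \<Longrightarrow>
        (\<Sum>n\<le>L. doubling_coeff a x n * (v n - prev v n)\<^sup>2) \<le> A * (\<Sum>n<L. (v n)\<^sup>2)"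
    and z: "z \<notin> complex_of_real ` {0..A}"
  shows "z \<in> resolvent_set (jacobi_op a x)"
proof -
  have "\<exists>w. Re w = A / 2 \<and> cmod w < cmod (z - w)"
  proof -
    \<comment> \<open>For nonreal \<open>z\<close> the centre moves to the other side of the real
      axis, far enough for the disc through 0 and \<open>A\<close> to miss \<open>z\<close>. A real
      \<open>z\<close> off the segment is already missed with centre \<open>A / 2\<close>.\<close>
    define s where "s = (if Im z = 0 then 0 else - ((Re z - A / 2)\<^sup>2 + (A / 2)\<^sup>2 + 1) / Im z)"
    have "(A / 2)\<^sup>2 + s\<^sup>2 < (Re z - A / 2)\<^sup>2 + (Im z - s)\<^sup>2"
    proof (cases "Im z = 0")
      case True
      with z have "Re z < 0 \<or> A < Re z"
        by (force simp: image_iff complex_eq_iff)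
      then have "\<bar>A / 2\<bar> < \<bar>Re z - A / 2\<bar>"
        using A by auto
      then have "(A / 2)\<^sup>2 < (Re z - A / 2)\<^sup>2"
        using abs_le_square_iff[of "Re z - A / 2" "A / 2"] by linarith
      then show ?thesis
        using True by (simp add: s_def)
    next
      case False
      then have "Im z * s = - ((Re z - A / 2)\<^sup>2 + (A / 2)\<^sup>2 + 1)"
        by (simp add: s_def)
      moreover have "(Im z - s)\<^sup>2 = (Im z)\<^sup>2 - 2 * (Im z * s) + s\<^sup>2"
        by (simp add: power2_eq_square algebra_simps)
      ultimately have "(Re z - A / 2)\<^sup>2 + (Im z - s)\<^sup>2 - ((A / 2)\<^sup>2 + s\<^sup>2)
          = 3 * (Re z - A / 2)\<^sup>2 + (Im z)\<^sup>2 + (A / 2)\<^sup>2 + 2"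
        by simp
      moreover have "\<dots> > 0"
        by (rule add_nonneg_pos) auto
      ultimately show ?thesis
        by linarith
    qed
    then have "cmod (Complex (A / 2) s) < cmod (z - Complex (A / 2) s)"
      by (simp add: cmod_def)
    then show ?thesis
      by (metis complex.sel(1))
  qed
  then obtain w where w: "Re w = A / 2" "cmod w < cmod (z - w)"
    by blast
  show ?thesis
  proof (rule resolvent_set_outside_disc[OF _ _ _ norm_ge_zero w(2)])
    show "jacobi_op a x (\<lambda>n. u n - v n) n = jacobi_op a x u n - jacobi_op a x v n" for u v n
      by (simp add: jacobi_op_def algebra_simps)
    show "(\<lambda>k. jacobi_op a x (u k) n) \<longlonglongrightarrow> jacobi_op a x w n"
      if "\<And>m. (\<lambda>k. u k m) \<longlonglongrightarrow> w m" for u w n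
      unfolding jacobi_op_def
      by (cases "n = 0") (auto intro!: tendsto_intros that)
    fix u assume u: "u \<in> l2"
    show "shift_op (jacobi_op a x) w u \<in> l2 \<and>
        l2_norm (shift_op (jacobi_op a x) w u) \<le> cmod w * l2_norm u"
      unfolding l2_bound_iff
    proof
      fix N
      define v where "v n = (if n \<le> N then u n else 0)" for n
      let ?S = "shift_op (jacobi_op a x) w"
      have "(\<Sum>n<N. (cmod (?S u n))\<^sup>2) = (\<Sum>n<N. (cmod (?S v n))\<^sup>2)"
        by (intro sum.cong) (auto simp: shift_op_def jacobi_op_def v_def)
      also have "\<dots> \<le> (\<Sum>n<Suc (Suc N). (cmod (?S v n))\<^sup>2)"
        by (intro sum_mono2) auto
      also have "\<dots> \<le> (cmod w)\<^sup>2 * (\<Sum>n<Suc N. (cmod (v n))\<^sup>2)"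
        unfolding shift_op_def jacobi_op_eq_jac
        by (rule jac_complex_norm_bound[OF b A form]) (auto simp: v_def w)
      also have "(\<Sum>n<Suc N. (cmod (v n))\<^sup>2) = (\<Sum>n<Suc N. (cmod (u n))\<^sup>2)"
        by (intro sum.cong) (auto simp: v_def)
      finally have "L2_set (\<lambda>n. cmod (?S u n)) {..<N}
          \<le> cmod w * L2_set (\<lambda>n. cmod (u n)) {..<Suc N}"
        unfolding L2_set_def
        by (metis norm_ge_zero real_sqrt_le_iff real_sqrt_mult real_sqrt_unique)
      also have "\<dots> \<le> cmod w * l2_norm u"
        by (intro mult_left_mono L2_set_le_l2_norm u) simp
      finally show "L2_set (\<lambda>n. cmod (?S u n)) {..<N} \<le> cmod w * l2_norm u" .
    qed
  qed
qed

section \<open>Orbits of the doubling map\<close>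

lemma periodic_int:
  fixes g :: "real \<Rightarrow> 'b"
  assumes "\<And>x. g (x + 1) = g x"
  shows "g (x + of_int k) = g x"
proof -
  have nat: "g (x + real n) = g x" for x n
  proof (induction n)
    case (Suc n)
    then show ?case
      using assms[of "x + real n"] by (simp add: add_ac)
  qed simp
  show ?thesis
  proof (cases "0 \<le> k")
    case True
    then show ?thesis
      using nat[of x "nat k"] by simp
  next
    case False
    then have "x + of_int k + real (nat (- k)) = x"
      by simp
    then show ?thesis
      using nat[of "x + of_int k" "nat (- k)"] by metis
  qed
qed

lemma periodic_frac:
  fixes g :: "real \<Rightarrow> 'b"
  assumes "\<And>x. g (x + 1) = g x"
  shows "g (frac x) = g x"
proof -
  have "frac x = x + of_int (- \<lfloor>x\<rfloor>)"
    by (simp add: frac_def)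
  then show ?thesis
    using periodic_int[of g, OF assms] by metis
qed

section \<open>Almost every orbit is dense\<close>

definition dense_orbit :: "real \<Rightarrow> bool" where
  "dense_orbit x \<longleftrightarrow>
     (\<forall>s t n0. 0 \<le> s \<longrightarrow> s < t \<longrightarrow> t \<le> 1 \<longrightarrow> (\<exists>k\<ge>n0. s < frac (2 ^ k * x) \<and> frac (2 ^ k * x) < t))"

text \<open>Used in contrapositive form: an inequality \<open>G \<le> 0\<close> along a tail of a
  dense orbit extends to every base point.\<close>

lemma dense_orbit_positive:
  fixes G :: "real \<Rightarrow> real"
  assumes x: "dense_orbit x" and G: "continuous_on UNIV G" "\<And>y. G (y + 1) = G y" "0 < G y"
  shows "\<exists>k\<ge>n0. 0 < G (2 ^ k * x)"
proof -
  have "open {t. 0 < G t}"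
    using G(1) by (intro open_Collect_less) auto
  moreover have "frac y \<in> {t. 0 < G t}"
    using G(3) periodic_frac[of G y, OF G(2)] by simp
  ultimately obtain e where e: "e > 0" "\<And>t. dist t (frac y) < e \<Longrightarrow> 0 < G t"
    unfolding open_dist by auto
  have "frac y < min 1 (frac y + e)"
    using e frac_lt_1[of y] by simp
  then obtain k where "k \<ge> n0" "frac y < frac (2 ^ k * x)" "frac (2 ^ k * x) < min 1 (frac y + e)"
    using x[unfolded dense_orbit_def, rule_format, OF frac_ge_0 _ min.cobounded1] by blast
  then have "0 < G (frac (2 ^ k * x))"
    by (intro e(2)) (simp add: dist_real_def)
  then show ?thesis
    using \<open>k \<ge> n0\<close> periodic_frac[of G, OF G(2)] by auto
qed

text \<open>Only times divisible by \<open>m\<close> are sampled. The dyadic cells of length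
  \<open>1 / 2 ^ m\<close> are the ranges of the inverse branches of multiplication by
  \<open>2 ^ m\<close> modulo 1, which makes these sets self-similar.\<close>

definition avoiding :: "nat \<Rightarrow> nat \<Rightarrow> nat \<Rightarrow> real set" where
  "avoiding m j n0 = {x \<in> {0..<1}. \<forall>n\<ge>n0. \<lfloor>2 ^ m * frac (2 ^ (m * n) * x)\<rfloor> \<noteq> int j}"

lemma borel_avoiding: "avoiding m j n0 \<in> sets borel"
proof -
  define f where "f n = (\<lambda>x::real. real_of_int \<lfloor>2 ^ m * frac (2 ^ (m * n) * x)\<rfloor>)" for n
  have "f n \<in> borel_measurable borel" for n
    unfolding f_def frac_def by measurable
  then have "f n -` (- {real j}) \<in> sets borel" for n
    by (rule measurable_sets_borel) simp
  then have "{0..<1} \<inter> (\<Inter>n\<in>{n0..}. f n -` (- {real j})) \<in> sets borel"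
    by (intro sets.Int sets.countable_INT') auto
  moreover have eq: "of_int k = real j \<longleftrightarrow> k = int j" for k :: int
    by (metis of_int_eq_iff of_int_of_nat_eq)
  have "{0..<1} \<inter> (\<Inter>n\<in>{n0..}. f n -` (- {real j})) = avoiding m j n0"
    unfolding avoiding_def f_def by (rule set_eqI, simp add: eq, simp add: Ball_def)
  ultimately show ?thesis
    by simp
qed

text \<open>\<open>y\<close> is the image of \<open>x\<close>, and \<open>i\<close> is the cell of
  \<open>x\<close>. Truncated subtraction matters: for \<open>n0 = 0\<close> the set is mapped into
  itself, while cell \<open>j\<close> is forbidden at time 0.\<close>

lemma avoiding_branches:
  assumes "x \<in> avoiding m j n0"
  shows "\<exists>i<2 ^ m. \<exists>y\<in>avoiding m j (n0 - 1). x = y / 2 ^ m + real i / 2 ^ m \<and> (n0 = 0 \<longrightarrow> i \<noteq> j)"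
proof -
  define y where "y = frac (2 ^ m * x)"
  define i where "i = nat \<lfloor>2 ^ m * x\<rfloor>"
  have x: "0 \<le> x" "x < 1"
    using assms by (auto simp: avoiding_def)
  then have i0: "0 \<le> \<lfloor>2 ^ m * x\<rfloor>"
    by simp
  have "\<lfloor>2 ^ m * x\<rfloor> < 2 ^ m"
    using x by (simp add: floor_less_iff)
  then have i: "i < 2 ^ m"
    using i0 by (simp add: i_def nat_less_iff)
  have y: "y = 2 ^ m * x - real i"
    using i0 by (simp add: y_def i_def frac_def)
  have "frac (2 ^ (m * n) * y) = frac (2 ^ (m * Suc n) * x)" for n
  proof -
    have "2 ^ (m * n) * y = 2 ^ (m * Suc n) * x + of_int (- (2 ^ (m * n) * int i))"
      by (simp add: y power_add algebra_simps)
    then show ?thesis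
      using periodic_int[of "frac :: real \<Rightarrow> real", OF frac_1_eq] by metis
  qed
  moreover have "\<lfloor>2 ^ m * frac (2 ^ (m * Suc n) * x)\<rfloor> \<noteq> int j" if "n \<ge> n0 - 1" for n
    using assms that unfolding avoiding_def by (auto simp del: mult_Suc_right)
  moreover have "y \<in> {0..<1}"
    by (simp add: y_def frac_lt_1)
  ultimately have "y \<in> avoiding m j (n0 - 1)"
    unfolding avoiding_def by auto
  moreover have "x = y / 2 ^ m + real i / 2 ^ m"
    by (simp add: y field_simps)
  moreover have "i \<noteq> j" if "n0 = 0"
  proof -
    have "frac x = x"
      using x by (simp add: frac_eq)
    then have "\<lfloor>2 ^ m * x\<rfloor> \<noteq> int j"
      using assms that by (auto simp: avoiding_def dest: spec[of _ 0])
    then show ?thesis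
      using i0 unfolding i_def by linarith
  qed
  ultimately show ?thesis
    using i by blast
qed

lemma bounded_avoiding: "bounded (avoiding m j n0)"
  by (rule bounded_subset[of "{0..1}"]) (auto simp: avoiding_def)

lemma lmeasurable_avoiding: "avoiding m j n0 \<in> lmeasurable"
proof (rule bounded_set_imp_lmeasurable[OF bounded_avoiding])
  show "avoiding m j n0 \<in> sets lebesgue"
    using borel_avoiding by simp
qed

text \<open>
  The base case avoids the cell at time \<open>0\<close>, so one of the \<open>2 ^ m\<close> inverse branches is missing and
  the measure contracts by the factor \<open>1 - 2 ^ -m\<close>.
\<close>

lemma measure_avoiding:
  assumes j: "j < 2 ^ m"
  shows "measure lebesgue (avoiding m j n0) = 0"
proof -
  define br where "br i n = (\<lambda>y. (1 / 2 ^ m) *\<^sub>R y + real i / 2 ^ m) ` avoiding m j n" for i :: nat and n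
  have br: "br i n \<in> lmeasurable" for i n
  proof (rule bounded_set_imp_lmeasurable)
    have "br i n = (\<lambda>x. 2 ^ m * x - real i) -` avoiding m j n"
    proof (intro subset_antisym subsetI)
      fix x assume "x \<in> (\<lambda>x. 2 ^ m * x - real i) -` avoiding m j n"
      then show "x \<in> br i n"
        unfolding br_def by (intro image_eqI[of _ _ "2 ^ m * x - real i"]) (simp_all add: diff_divide_distrib)
    qed (auto simp: br_def distrib_left)
    also have "\<dots> \<in> sets borel"
      by (rule measurable_sets_borel[OF _ borel_avoiding]) measurable
    finally show "br i n \<in> sets lebesgue"
      by simp
    show "bounded (br i n)"
      using bounded_translation[OF bounded_scaling[OF bounded_avoiding], of "real i / 2 ^ m" "1 / 2 ^ m" m j n]
      by (simp add: br_def image_image add.commute)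
  qed
  have mbr: "measure lebesgue (br i n) = measure lebesgue (avoiding m j n) / 2 ^ m" for i n
    unfolding br_def by (subst measure_lebesgue_affine) simp
  have bound: "measure lebesgue (avoiding m j n)
      \<le> real (card I) * (measure lebesgue (avoiding m j k) / 2 ^ m)"
    if "finite I" "avoiding m j n \<subseteq> (\<Union>i\<in>I. br i k)" for I n k
  proof -
    have "measure lebesgue (avoiding m j n) \<le> measure lebesgue (\<Union>i\<in>I. br i k)"
      using that br by (intro measure_mono_fmeasurable) (auto simp: borel_avoiding intro: fmeasurable.finite_UN)
    also have "\<dots> \<le> (\<Sum>i\<in>I. measure lebesgue (br i k))"
      using that br by (intro measure_UNION_le) (auto simp: fmeasurableD)
    finally show ?thesis
      by (simp add: mbr)
  qed
  show ?thesis
  proof (induction n0)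
    case 0
    have "avoiding m j 0 \<subseteq> (\<Union>i\<in>{..<2 ^ m} - {j}. br i 0)"
    proof
      fix x assume "x \<in> avoiding m j 0"
      from avoiding_branches[OF this] obtain i y where
        "i < 2 ^ m" "y \<in> avoiding m j 0" "x = y / 2 ^ m + real i / 2 ^ m" "i \<noteq> j"
        by auto
      then show "x \<in> (\<Union>i\<in>{..<2 ^ m} - {j}. br i 0)"
        unfolding br_def by (intro UN_I[of i] image_eqI[of _ _ y]) auto
    qed
    from bound[OF _ this] j have "measure lebesgue (avoiding m j 0)
        \<le> (2 ^ m - 1) * (measure lebesgue (avoiding m j 0) / 2 ^ m)"
      by (simp add: of_nat_diff)
    then have "measure lebesgue (avoiding m j 0) \<le> 0"
      by (simp add: field_simps)
    then show ?case
      by (simp add: measure_le_0_iff)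
  next
    case (Suc n)
    have "avoiding m j (Suc n) \<subseteq> (\<Union>i\<in>{..<2 ^ m}. br i n)"
    proof
      fix x assume "x \<in> avoiding m j (Suc n)"
      from avoiding_branches[OF this] obtain i y where
        "i < 2 ^ m" "y \<in> avoiding m j n" "x = y / 2 ^ m + real i / 2 ^ m"
        by auto
      then show "x \<in> (\<Union>i\<in>{..<2 ^ m}. br i n)"
        unfolding br_def by (intro UN_I[of i] image_eqI[of _ _ y]) auto
    qed
    from bound[OF _ this] Suc show ?case
      by (simp add: measure_le_0_iff)
  qed
qed

lemma AE_dense_orbit: "AE x in circle_measure. dense_orbit x"
proof -
  have null: "avoiding m j n0 \<in> null_sets lborel" if "j < 2 ^ m" for m j n0
  proof -
    have "emeasure lebesgue (avoiding m j n0) = 0"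
      using emeasure_eq_measure2[OF lmeasurable_avoiding] measure_avoiding[OF that] by simp
    then show ?thesis
      using borel_avoiding by (simp add: null_sets_def)
  qed
  have "AE x in lborel. \<forall>m j n0. j < 2 ^ m \<longrightarrow> x \<notin> avoiding m j n0"
    unfolding AE_all_countable by (auto intro!: AE_not_in null)
  then have "AE x in lborel. x \<in> {0..<1} \<longrightarrow> dense_orbit x"
  proof eventually_elim
    case (elim x)
    show ?case
      unfolding dense_orbit_def
    proof (intro impI allI)
      fix s t :: real and n0 :: nat
      assume x: "x \<in> {0..<1}" and st: "0 \<le> s" "s < t" "t \<le> 1"
      obtain m where m: "(1 / 2) ^ m < (t - s) / 2"
        using real_arch_pow_inv[of "(t - s) / 2" "1 / 2"] st by auto
      then have m': "2 / 2 ^ m < t - s"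
        by (simp add: power_divide)
      with st have "m \<noteq> 0"
        by (cases m) auto
      \<comment> \<open>The cell with number \<open>j\<close> begins strictly to the right of
        \<open>s\<close>; as \<open>t - s\<close> exceeds two cell lengths, it ends before
        \<open>t\<close>.\<close>
      define j where "j = nat \<lfloor>2 ^ m * s\<rfloor> + 1"
      have j1: "2 ^ m * s < real j" "real j \<le> 2 ^ m * s + 1"
        using st by (simp_all add: j_def) linarith+
      have t: "2 ^ m * s + 2 < 2 ^ m * t"
        using m' by (simp add: field_simps)
      have "2 ^ m * t \<le> 2 ^ m"
        using st by simp
      then have "real j < 2 ^ m"
        using j1 t by linarith
      then have "j < 2 ^ m"
        by (metis of_nat_less_numeral_power_cancel_iff)
      then have "x \<notin> avoiding m j n0"
        using elim by blast
      then obtain n where n: "n \<ge> n0" "\<lfloor>2 ^ m * frac (2 ^ (m * n) * x)\<rfloor> = int j"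
        using x unfolding avoiding_def by blast
      then have "real j \<le> 2 ^ m * frac (2 ^ (m * n) * x)" "2 ^ m * frac (2 ^ (m * n) * x) < real j + 1"
        by linarith+
      then have "2 ^ m * s < 2 ^ m * frac (2 ^ (m * n) * x)" "2 ^ m * frac (2 ^ (m * n) * x) < 2 ^ m * t"
        using j1 t by linarith+
      then have "s < frac (2 ^ (m * n) * x) \<and> frac (2 ^ (m * n) * x) < t"
        by simp
      moreover have "n0 \<le> m * n"
        using n \<open>m \<noteq> 0\<close> by (cases m) auto
      ultimately show "\<exists>k\<ge>n0. s < frac (2 ^ k * x) \<and> frac (2 ^ k * x) < t"
        by blast
    qed
  qed
  then show ?thesis
    unfolding circle_measure_def by (subst AE_restrict_space_iff) auto
qed

section \<open>Uniform lower bounds along dense orbits\<close>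

locale circle_coeff =
  fixes a :: "real \<Rightarrow> real" and lo hi :: real
  assumes cont: "continuous_on UNIV a" and per: "\<And>x. a (x + 1) = a x"
    and lo_pos: "0 < lo" and lo: "\<And>x. lo \<le> a x" and hi: "\<And>x. a x \<le> hi"
begin

lemma a_pos: "0 < a x"
  using lo[of x] lo_pos by linarith

lemma hi_pos: "0 < hi"
  using hi[of 0] a_pos[of 0] by linarith

definition cf :: "real \<Rightarrow> nat \<Rightarrow> real" where
  "cf y n = a (2 ^ n * y)"

lemma doubling_coeff_eq_cf: "doubling_coeff a x = cf x"
  by (rule ext) (simp add: doubling_coeff_def cf_def periodic_frac[of a, OF per])

lemma cf_pos: "0 < cf y n"
  by (simp add: cf_def a_pos)

lemma cf_add: "cf y (k + n) = cf (2 ^ k * y) n"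
  by (simp add: cf_def power_add mult.assoc mult.commute mult.left_commute)

lemma continuous_cf: "continuous_on UNIV (\<lambda>y. cf y n)"
  unfolding cf_def by (rule continuous_on_compose2[OF cont]) (auto intro!: continuous_intros)

lemma cf_periodic: "cf (y + 1) n = cf y n"
proof -
  have "2 ^ n * (y + 1) = 2 ^ n * y + of_int (2 ^ n)"
    by (simp add: algebra_simps)
  then show ?thesis
    unfolding cf_def using periodic_int[of a, OF per] by metis
qed

definition below_form :: "real \<Rightarrow> bool" where
  "below_form B \<longleftrightarrow> (\<forall>y L (u :: nat \<Rightarrow> real). (\<forall>n\<ge>L. u n = 0) \<longrightarrow>
     (\<Sum>n\<le>L. cf y n * (u n - prev u n)\<^sup>2) \<le> B * (\<Sum>n<L. (u n)\<^sup>2))"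

text \<open>Test sequences vanish at site 0 so that, translated to a site \<open>k\<close> of a
  half-line operator, they leave no residual at site \<open>k - 1\<close>. The bound then does not
  feel the boundary condition.\<close>

definition jac_bounded_below :: "real \<Rightarrow> real \<Rightarrow> bool" where
  "jac_bounded_below E C \<longleftrightarrow> (\<forall>y N (u :: nat \<Rightarrow> real). u 0 = 0 \<longrightarrow> (\<forall>n\<ge>N. u n = 0) \<longrightarrow>
     (\<Sum>n<N. (u n)\<^sup>2) \<le> C\<^sup>2 * (\<Sum>n<Suc N. (jac (cf y) u n - E * u n)\<^sup>2))"

text \<open>Planted at site \<open>k\<close> of \<open>H(x)\<close>, the sequence sees the
  coefficients of the base point \<open>2 ^ k * x\<close>. For fixed \<open>u\<close> both sides are
  finite sums continuous in the base point, so density of the orbit gives all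
  \<open>y\<close>.\<close>

lemma jac_bounded_below_transfer:
  assumes x: "dense_orbit x"
    and below: "\<And>u. u \<in> l2 \<Longrightarrow>
        l2_norm u \<le> C * l2_norm (shift_op (jacobi_op a x) (complex_of_real E) u)"
  shows "jac_bounded_below E C"
  unfolding jac_bounded_below_def
proof (intro allI impI)
  fix y :: real and N :: nat and u :: "nat \<Rightarrow> real"
  assume u0: "u 0 = 0" and uN: "\<forall>n\<ge>N. u n = 0"
  define G where
    "G y = (\<Sum>n<N. (u n)\<^sup>2) - C\<^sup>2 * (\<Sum>n<Suc N. (jac (cf y) u n - E * u n)\<^sup>2)" for y
  have G_cont: "continuous_on UNIV G"
    unfolding G_def jac_def by (intro continuous_intros continuous_cf)
  have "G (y + 1) = G y" for y
    by (simp add: G_def jac_def cf_periodic)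
  note pos = dense_orbit_positive[OF x G_cont this, of y 0]
  have "G (2 ^ k * x) \<le> 0" for k
  proof -
    define U where "U n = (if n < k then 0 else complex_of_real (u (n - k)))" for n
    define V where "V = shift_op (jacobi_op a x) (complex_of_real E) U"
    have V: "V n = (if n < k then 0
        else complex_of_real (jac (cf (2 ^ k * x)) u (n - k) - E * u (n - k)))" for n
    proof (cases "n < k")
      case True
      then consider "Suc n < k" | "Suc n = k"
        by linarith
      then show ?thesis
        by cases (use True u0 in \<open>auto simp: V_def U_def shift_op_def jacobi_op_def\<close>)
    next
      case False
      then obtain m where n: "n = k + m"
        using le_Suc_ex not_le by blast
      show ?thesis
        using u0 cf_add[of x k m] cf_add[of x k "Suc m"]
        by (cases m) (auto simp: n V_def U_def shift_op_def jacobi_op_def doubling_coeff_eq_cf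
          jac_def prev_def algebra_simps)
    qed
    have shift: "(\<Sum>n<k + M. f n) = (\<Sum>n<M. f (k + n))" if "\<And>n. n < k \<Longrightarrow> f n = 0"
      for f :: "nat \<Rightarrow> real" and M
      by (induction M) (simp_all add: that)
    have U0: "U n = 0" if "n \<ge> k + N" for n
      using uN that by (auto simp: U_def)
    have V0: "V n = 0" if "n \<ge> k + Suc N" for n
      using uN that by (auto simp: V jac_def prev_def)
    have "l2_norm U \<le> C * l2_norm V"
      using below[of U] l2_finite_support(1)[of "k + N" U] U0 by (simp add: V_def)
    then have "(l2_norm U)\<^sup>2 \<le> (C * l2_norm V)\<^sup>2"
      using l2_norm_nonneg l2_finite_support(1)[of "k + N" U] U0 by (intro power_mono) auto
    then have "(l2_norm U)\<^sup>2 \<le> C\<^sup>2 * (l2_norm V)\<^sup>2"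
      by (simp add: power_mult_distrib)
    then have "(\<Sum>n<k + N. (cmod (U n))\<^sup>2) \<le> C\<^sup>2 * (\<Sum>n<k + Suc N. (cmod (V n))\<^sup>2)"
      using l2_finite_support(2)[of "k + N" U] l2_finite_support(2)[of "k + Suc N" V] U0 V0 by metis
    then have "(\<Sum>n<N. (cmod (U (k + n)))\<^sup>2) \<le> C\<^sup>2 * (\<Sum>n<Suc N. (cmod (V (k + n)))\<^sup>2)"
      by (subst (asm) (1 2) shift) (auto simp: U_def V)
    then show ?thesis
      by (simp add: G_def U_def V del: of_real_diff of_real_mult)
  qed
  with pos have "G y \<le> 0"
    by (meson not_le)
  then show "(\<Sum>n<N. (u n)\<^sup>2) \<le> C\<^sup>2 * (\<Sum>n<Suc N. (jac (cf y) u n - E * u n)\<^sup>2)"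
    by (simp add: G_def)
qed

end

section \<open>The transfer cocycle\<close>

text \<open>
  If \<open>(H - E) u = 0\<close> then \<open>s\<^sub>n = (-1)\<^sup>n u\<^sub>n\<^sub>-\<^sub>1\<close> solves a recurrence with positive off-diagonal
  coefficients; \<open>step\<close> advances the state \<open>s\<^sub>n + \<i> a\<^sub>n s\<^sub>n\<^sub>+\<^sub>1\<close>. It has determinant one.
\<close>

definition step :: "(real \<Rightarrow> real) \<Rightarrow> real \<Rightarrow> real \<Rightarrow> complex \<Rightarrow> complex" where
  "step a E y z = Complex (Im z / a y) ((E - a y - a (2 * y)) * (Im z / a y) - a y * Re z)"

primrec orb :: "(real \<Rightarrow> real) \<Rightarrow> real \<Rightarrow> real \<Rightarrow> complex \<Rightarrow> nat \<Rightarrow> complex" where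
  "orb a E y z 0 = z"
| "orb a E y z (Suc n) = step a E (2 ^ n * y) (orb a E y z n)"

definition wronskian :: "complex \<Rightarrow> complex \<Rightarrow> real" where
  "wronskian z w = Re z * Im w - Im z * Re w"

lemma step_linear:
  "step a E y (of_real r * z + of_real s * w) = of_real r * step a E y z + of_real s * step a E y w"
  by (simp add: step_def complex_eq_iff algebra_simps add_divide_distrib)

lemma orb_linear:
  "orb a E y (of_real r * z + of_real s * w) n = of_real r * orb a E y z n + of_real s * orb a E y w n"
  by (induction n) (simp_all add: step_linear)

lemma orb_scale: "orb a E y (of_real r * z) n = of_real r * orb a E y z n"
  using orb_linear[of a E y r z 0 0 n] by simp

lemma orb_Suc_shift: "orb a E y z (Suc n) = orb a E (2 * y) (step a E y z) n"
  by (induction n) (simp_all add: mult_ac)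

context circle_coeff
begin

lemma wronskian_step: "wronskian (step a E y z) (step a E y w) = wronskian z w"
  using a_pos[of y] by (simp add: wronskian_def step_def field_simps)

lemma wronskian_orb: "wronskian (orb a E y z n) (orb a E y w n) = wronskian z w"
  by (induction n) (simp_all add: wronskian_step)

lemma orb_surj: "\<exists>z. orb a E y z n = w"
proof (induction n arbitrary: w)
  case (Suc n)
  define t where "t = 2 ^ n * y"
  define v where "v = Complex (((E - a t - a (2 * t)) * Re w - Im w) / a t) (a t * Re w)"
  have "step a E t v = w"
    using a_pos[of t] by (simp add: v_def step_def complex_eq_iff)
  then show ?case
    using Suc[of v] by (auto simp: t_def)
qed simp

lemma step_periodic: "step a E (y + 1) z = step a E y z"
proof -
  have "a (2 * (y + 1)) = a (2 * y)"
    using per[of "2 * y"] per[of "2 * y + 1"] by (simp add: add.assoc)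
  then show ?thesis
    by (simp add: step_def per)
qed

lemma orb_periodic: "orb a E (y + 1) z n = orb a E y z n"
proof (induction n)
  case (Suc n)
  have "2 ^ n * (y + 1) = 2 ^ n * y + of_int (2 ^ n)"
    by (simp add: algebra_simps)
  then have "step a E (2 ^ n * (y + 1)) = step a E (2 ^ n * y)"
    using periodic_int[of "step a E"] step_periodic by (metis ext)
  then show ?case
    by (simp add: Suc)
qed simp

lemma continuous_step:
  assumes "continuous_on UNIV f" "continuous_on UNIV g"
  shows "continuous_on UNIV (\<lambda>y::real. step a E (f y) (g y))"
proof -
  have "continuous_on UNIV (\<lambda>y. a (f y))" "continuous_on UNIV (\<lambda>y. a (2 * f y))"
    by (rule continuous_on_compose2[OF cont]; auto intro!: continuous_intros assms)+
  moreover have "a y \<noteq> 0" for y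
    using a_pos[of y] by simp
  ultimately show ?thesis
    unfolding step_def by (intro continuous_intros assms) auto
qed

lemma continuous_orb: "continuous_on UNIV (\<lambda>y. orb a E y z n)"
  by (induction n) (auto intro!: continuous_intros continuous_step)

lemma Im_orb: "Im (orb a E y z n) = cf y n * Re (orb a E y z (Suc n))"
  using a_pos[of "2 ^ n * y"] by (simp add: step_def cf_def)

lemma orb_recurrence:
  "cf y (Suc n) * Re (orb a E y z (Suc (Suc n))) + cf y n * Re (orb a E y z n)
    = (E - cf y n - cf y (Suc n)) * Re (orb a E y z (Suc n))"
proof -
  have "Im (orb a E y z (Suc n)) =
      (E - cf y n - cf y (Suc n)) * Re (orb a E y z (Suc n)) - cf y n * Re (orb a E y z n)"
    by (simp add: step_def cf_def mult_ac)
  then show ?thesis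
    by (simp only: Im_orb)
qed

text \<open>Test sequence: the solution cut off to the window \<open>[1, N]\<close>; the residual lives at its ends.\<close>

lemma window_bound:
  assumes "jac_bounded_below E C" and N: "2 \<le> N"
  defines "s \<equiv> \<lambda>y z n. Re (orb a E y z n)"
  shows "(\<Sum>n=1..N. (s y z n)\<^sup>2)
    \<le> C\<^sup>2 * hi\<^sup>2 * ((s y z 0)\<^sup>2 + (s y z 1)\<^sup>2 + (s y z N)\<^sup>2 + (s y z (Suc N))\<^sup>2)"
proof -
  define t where "t = s y z"
  define u where "u n = (if 1 \<le> n \<and> n \<le> N then (-1) ^ n * t n else 0)" for n
  \<comment> \<open>\<open>y / 2\<close> is a preimage of \<open>y\<close> under doubling. It
    supplies a site 0 to the left of the window, where the test sequence can vanish.\<close>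
  define b where "b = cf (y / 2)"
  have b: "b (Suc n) = cf y n" for n
    by (simp add: b_def cf_def)
  have rec: "cf y (Suc n) * t (Suc (Suc n)) + cf y n * t n = (E - cf y n - cf y (Suc n)) * t (Suc n)" for n
    unfolding t_def s_def by (rule orb_recurrence)
  define r where "r n = jac b u n - E * u n" for n
  have r_in: "r (Suc (Suc n)) = 0" if "Suc (Suc n) < N" for n
  proof -
    have "r (Suc (Suc n)) = (-1) ^ n * (cf y (Suc (Suc n)) * t (Suc (Suc (Suc n)))
        + cf y (Suc n) * t (Suc n) - (E - cf y (Suc n) - cf y (Suc (Suc n))) * t (Suc (Suc n)))"
      using that by (simp add: r_def jac_def prev_def u_def b) (simp add: algebra_simps)
    then show ?thesis
      by (simp only: rec) simp
  qed
  obtain M where M: "N = Suc (Suc M)"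
    using N by (metis add_2_eq_Suc le_Suc_ex)
  have r0: "r 0 = cf y 0 * t 1"
    using N by (simp add: r_def jac_def prev_def u_def b)
  have r1: "r 1 = cf y 0 * t 0"
    using rec[of 0] N by (simp add: r_def jac_def prev_def u_def b eval_nat_numeral)
      (simp add: algebra_simps)
  have rN: "r N = - ((-1) ^ N * (cf y N * t (Suc N)))"
  proof -
    have "r N = - ((-1) ^ N * (cf y N * t (Suc N))) + (-1) ^ N * (cf y (Suc (Suc M)) * t (Suc (Suc (Suc M)))
        + cf y (Suc M) * t (Suc M) - (E - cf y (Suc M) - cf y (Suc (Suc M))) * t (Suc (Suc M)))"
      by (simp add: r_def jac_def prev_def u_def b M) (simp add: algebra_simps)
    then show ?thesis
      by (simp only: rec) simp
  qed
  have rN1: "r (Suc N) = - ((-1) ^ N * (cf y N * t N))"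
    using N by (simp add: r_def jac_def prev_def u_def b)
  have sign: "((-1 :: real) ^ n)\<^sup>2 = 1" for n
    by (simp flip: power_mult)
  have "(\<Sum>n=1..N. (t n)\<^sup>2) = (\<Sum>n<Suc N. (u n)\<^sup>2)"
    by (intro sum.mono_neutral_cong_left) (auto simp: u_def power_mult_distrib sign)
  also have "\<dots> \<le> C\<^sup>2 * (\<Sum>n<Suc (Suc N). (r n)\<^sup>2)"
    unfolding r_def b_def
    by (rule assms(1)[unfolded jac_bounded_below_def, rule_format]) (auto simp: u_def)
  also have "(\<Sum>n<Suc (Suc N). (r n)\<^sup>2) = (\<Sum>n\<in>{0, 1, N, Suc N}. (r n)\<^sup>2)"
  proof (rule sum.mono_neutral_right)
    show "\<forall>n\<in>{..<Suc (Suc N)} - {0, 1, N, Suc N}. (r n)\<^sup>2 = 0"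
    proof
      fix n assume n: "n \<in> {..<Suc (Suc N)} - {0, 1, N, Suc N}"
      then have "n = Suc (Suc (n - 2))" "n < N"
        by auto
      then show "(r n)\<^sup>2 = 0"
        using r_in[of "n - 2"] by simp
    qed
  qed (use N in auto)
  also have "\<dots> = (r 0)\<^sup>2 + (r 1)\<^sup>2 + (r N)\<^sup>2 + (r (Suc N))\<^sup>2"
    using N by simp
  also have "\<dots> = (cf y 0)\<^sup>2 * ((t 0)\<^sup>2 + (t 1)\<^sup>2) + (cf y N)\<^sup>2 * ((t N)\<^sup>2 + (t (Suc N))\<^sup>2)"
    unfolding r0 r1 rN rN1 by (simp add: power_mult_distrib sign algebra_simps)
  also have "\<dots> \<le> hi\<^sup>2 * ((t 0)\<^sup>2 + (t 1)\<^sup>2) + hi\<^sup>2 * ((t N)\<^sup>2 + (t (Suc N))\<^sup>2)"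
    by (intro add_mono mult_right_mono power_mono) (auto simp: cf_def hi less_imp_le[OF a_pos])
  also have "\<dots> = hi\<^sup>2 * ((t 0)\<^sup>2 + (t 1)\<^sup>2 + (t N)\<^sup>2 + (t (Suc N))\<^sup>2)"
    by (simp add: algebra_simps)
  finally show ?thesis
    by (simp add: t_def mult.assoc mult_left_mono)
qed

text \<open>Substitute for an exponential dichotomy, with \<open>D\<close> uniform in base point,
  initial state and window length: an orbit small at both ends of a window is small inside
  it.\<close>

definition no_bump :: "real \<Rightarrow> real \<Rightarrow> bool" where
  "no_bump E D \<longleftrightarrow> (\<forall>y z N. (\<Sum>n<N. (cmod (orb a E y z n))\<^sup>2)
     \<le> D * ((cmod z)\<^sup>2 + (cmod (orb a E y z N))\<^sup>2))"

text \<open>\<open>window_bound\<close> controls the scalar solution and \<open>no_bump\<close> the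
  states. The two are comparable because the coefficients lie between \<open>lo\<close> and
  \<open>hi\<close>; the factor \<open>l\<close> converts states back to solution values.\<close>

lemma no_bumpI:
  assumes "jac_bounded_below E C"
  shows "\<exists>D>0. no_bump E D"
proof -
  define l where "l = 1 + 1 / lo\<^sup>2"
  define D where "D = (1 + hi\<^sup>2) * (1 + C\<^sup>2 * hi\<^sup>2 * l)"
  have l: "1 \<le> l"
    by (simp add: l_def)
  have D: "1 \<le> D"
    unfolding D_def using l by (simp add: algebra_simps)
  have "(\<Sum>n<N. (cmod (orb a E y z n))\<^sup>2) \<le> D * ((cmod z)\<^sup>2 + (cmod (orb a E y z N))\<^sup>2)" for y z N
  proof -
    define o' where "o' = orb a E y z"
    define s where "s n = Re (o' n)" for n
    have o_sq: "(cmod (o' n))\<^sup>2 = (s n)\<^sup>2 + (cf y n)\<^sup>2 * (s (Suc n))\<^sup>2" for n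
      using Im_orb[of E y z n] by (simp add: cmod_power2 o'_def s_def power_mult_distrib)
    have upper: "(cmod (o' n))\<^sup>2 \<le> (s n)\<^sup>2 + hi\<^sup>2 * (s (Suc n))\<^sup>2" for n
      unfolding o_sq using cf_pos[of y n] hi by (intro add_left_mono mult_right_mono power_mono) (auto simp: cf_def)
    have lower: "(s n)\<^sup>2 + (s (Suc n))\<^sup>2 \<le> l * (cmod (o' n))\<^sup>2" for n
    proof -
      have "lo\<^sup>2 * (s (Suc n))\<^sup>2 \<le> (cf y n)\<^sup>2 * (s (Suc n))\<^sup>2"
        using lo_pos lo by (intro mult_right_mono power_mono) (auto simp: cf_def)
      also have "\<dots> \<le> (cmod (o' n))\<^sup>2"
        by (simp add: o_sq)
      finally have "(s (Suc n))\<^sup>2 \<le> (cmod (o' n))\<^sup>2 / lo\<^sup>2"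
        using lo_pos by (simp add: field_simps)
      moreover have "(s n)\<^sup>2 \<le> (cmod (o' n))\<^sup>2"
        by (simp add: o_sq)
      ultimately show ?thesis
        by (simp add: l_def algebra_simps)
    qed
    consider "N = 0" | "N = 1" | "2 \<le> N"
      by linarith
    then show ?thesis
    proof cases
      case 1
      then show ?thesis using D by simp
    next
      case 2
      then show ?thesis
        using mult_right_mono[OF D, of "(cmod z)\<^sup>2"] mult_nonneg_nonneg[of D] D
        by (simp add: distrib_left add_increasing2)
    next
      case 3
      define S where "S = (\<Sum>n=1..N. (s n)\<^sup>2)"
      define Q where "Q = (cmod z)\<^sup>2 + (cmod (o' N))\<^sup>2"
      have Q0: "0 \<le> Q"
        by (simp add: Q_def)
      have "S \<le> C\<^sup>2 * hi\<^sup>2 * ((s 0)\<^sup>2 + (s 1)\<^sup>2 + (s N)\<^sup>2 + (s (Suc N))\<^sup>2)"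
        using window_bound[OF assms 3, of y z] by (simp add: S_def s_def o'_def)
      also have "\<dots> \<le> C\<^sup>2 * hi\<^sup>2 * (l * Q)"
        using lower[of 0] lower[of N] by (intro mult_left_mono) (auto simp: Q_def o'_def distrib_left)
      finally have S: "S \<le> C\<^sup>2 * hi\<^sup>2 * l * Q"
        by (simp add: mult.assoc)
      have S0: "0 \<le> S"
        by (simp add: S_def sum_nonneg)
      have "(s 0)\<^sup>2 \<le> Q"
        using o_sq[of 0] by (simp add: Q_def o'_def)
      have "(\<Sum>n<N. (cmod (o' n))\<^sup>2) \<le> (\<Sum>n<N. (s n)\<^sup>2) + hi\<^sup>2 * (\<Sum>n<N. (s (Suc n))\<^sup>2)"
        using upper by (simp add: sum_distrib_left sum_mono flip: sum.distrib)
      also have "(\<Sum>n<N. (s (Suc n))\<^sup>2) = S"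
        unfolding S_def by (rule sum.reindex_bij_witness[of _ "\<lambda>n. n - 1" Suc]) auto
      also have "(\<Sum>n<N. (s n)\<^sup>2) \<le> (\<Sum>n<Suc N. (s n)\<^sup>2)"
        by simp
      also have "(\<Sum>n<Suc N. (s n)\<^sup>2) = (s 0)\<^sup>2 + S"
        unfolding S_def by (subst sum.lessThan_Suc_shift) (simp add: sum.atLeast1_atMost_eq)
      also have "(s 0)\<^sup>2 + S + hi\<^sup>2 * S = (s 0)\<^sup>2 + (1 + hi\<^sup>2) * S"
        by (simp add: algebra_simps)
      also have "\<dots> \<le> (1 + hi\<^sup>2) * Q + (1 + hi\<^sup>2) * (C\<^sup>2 * hi\<^sup>2 * l * Q)"
      proof (intro add_mono mult_left_mono S)
        have "1 * Q \<le> (1 + hi\<^sup>2) * Q"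
          using Q0 by (intro mult_right_mono) auto
        with \<open>(s 0)\<^sup>2 \<le> Q\<close> show "(s 0)\<^sup>2 \<le> (1 + hi\<^sup>2) * Q"
          by simp
      qed simp
      also have "\<dots> = D * Q"
        by (simp add: D_def algebra_simps)
      finally show ?thesis
        by (simp add: Q_def o'_def)
    qed
  qed
  then show ?thesis
    using D unfolding no_bump_def by (intro exI[of _ D]) auto
qed

text \<open>At base point 0 the coefficients are constant, and \<open>cos (n * \<phi>)\<close> and
  \<open>sin (n * \<phi>)\<close> solve the recurrence; the range of \<open>E\<close> is the one
  where \<phi> is real. The end states stay bounded, but the two sums of squares add up to
  \<open>N\<close>.\<close>

lemma no_bump_plane_wave:
  assumes E: "0 \<le> E" "E \<le> 4 * a 0" and D: "0 < D"
  shows "\<not> no_bump E D"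
proof
  assume nb: "no_bump E D"
  define \<alpha> where "\<alpha> = a 0"
  have \<alpha>: "0 < \<alpha>"
    by (simp add: \<alpha>_def a_pos)
  define \<phi> where "\<phi> = arccos (E / (2 * \<alpha>) - 1)"
  have cos: "cos \<phi> = E / (2 * \<alpha>) - 1"
    unfolding \<phi>_def using E \<alpha> by (intro cos_arccos) (auto simp: \<alpha>_def field_simps)
  have E_eq: "(E - \<alpha> - \<alpha>) / \<alpha> = 2 * cos \<phi>"
    using \<alpha> by (simp add: cos field_simps)
  have gen: "(\<Sum>n<N. (f n)\<^sup>2) \<le> D * (2 * (1 + \<alpha>\<^sup>2))"
    if rec: "\<And>n. f (Suc (Suc n)) = 2 * cos \<phi> * f (Suc n) - f n" and f: "\<And>n. \<bar>f n\<bar> \<le> (1::real)" for f N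
  proof -
    have orb: "orb a E 0 (Complex (f 0) (\<alpha> * f 1)) n = Complex (f n) (\<alpha> * f (Suc n))" for n
    proof (induction n)
      case (Suc n)
      have "(E - \<alpha> - \<alpha>) * f (Suc n) - \<alpha> * f n = \<alpha> * ((E - \<alpha> - \<alpha>) / \<alpha> * f (Suc n) - f n)"
        using \<alpha> by (simp add: field_simps)
      then show ?case
        using Suc \<alpha> rec[of n] unfolding E_eq by (simp add: step_def flip: \<alpha>_def)
    qed simp
    have f2: "(f n)\<^sup>2 \<le> 1" for n
      using f[of n] by (simp add: abs_square_le_1)
    have c: "(cmod (Complex (f n) (\<alpha> * f (Suc n))))\<^sup>2 \<le> 1 + \<alpha>\<^sup>2" for n
      using f2[of n] mult_left_mono[OF f2[of "Suc n"], of "\<alpha>\<^sup>2"]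
      by (simp add: cmod_power2 power_mult_distrib)
    have "(\<Sum>n<N. (f n)\<^sup>2) \<le> (\<Sum>n<N. (cmod (Complex (f n) (\<alpha> * f (Suc n))))\<^sup>2)"
      by (intro sum_mono) (simp add: cmod_power2)
    also have "\<dots> \<le> D * ((cmod (Complex (f 0) (\<alpha> * f 1)))\<^sup>2 + (cmod (Complex (f N) (\<alpha> * f (Suc N))))\<^sup>2)"
      using nb[unfolded no_bump_def, rule_format, of 0 "Complex (f 0) (\<alpha> * f 1)" N] by (simp only: orb)
    also have "\<dots> \<le> D * (2 * (1 + \<alpha>\<^sup>2))"
      using c[of 0] c[of N] D by (intro mult_left_mono) auto
    finally show ?thesis .
  qed
  define R where "R = D * (2 * (1 + \<alpha>\<^sup>2))"
  obtain N where N: "2 * R < real N"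
    using reals_Archimedean2 by blast
  have cs: "cos (real (Suc (Suc n)) * \<phi>) = 2 * cos \<phi> * cos (real (Suc n) * \<phi>) - cos (real n * \<phi>)"
    "sin (real (Suc (Suc n)) * \<phi>) = 2 * cos \<phi> * sin (real (Suc n) * \<phi>) - sin (real n * \<phi>)" for n
  proof -
    define t where "t = real (Suc n) * \<phi>"
    have t: "real (Suc n) * \<phi> = t" "real (Suc (Suc n)) * \<phi> = t + \<phi>" "real n * \<phi> = t - \<phi>"
      by (simp_all add: t_def algebra_simps)
    show "cos (real (Suc (Suc n)) * \<phi>) = 2 * cos \<phi> * cos (real (Suc n) * \<phi>) - cos (real n * \<phi>)"
      "sin (real (Suc (Suc n)) * \<phi>) = 2 * cos \<phi> * sin (real (Suc n) * \<phi>) - sin (real n * \<phi>)"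
      unfolding t by (simp_all add: cos_add cos_diff sin_add sin_diff)
  qed
  have "real N = (\<Sum>n<N. (cos (real n * \<phi>))\<^sup>2 + (sin (real n * \<phi>))\<^sup>2)"
    by simp
  also have "\<dots> = (\<Sum>n<N. (cos (real n * \<phi>))\<^sup>2) + (\<Sum>n<N. (sin (real n * \<phi>))\<^sup>2)"
    by (rule sum.distrib)
  also have "\<dots> \<le> R + R"
    unfolding R_def by (intro add_mono gen cs) auto
  finally show False
    using N by simp
qed

end

section \<open>The stable direction\<close>

lemma abs_wronskian_le: "\<bar>wronskian z w\<bar> \<le> cmod z * cmod w"
proof -
  have "wronskian z w = Im (cnj z * w)"
    by (simp add: wronskian_def)
  then show ?thesis
    using abs_Im_le_cmod[of "cnj z * w"] by (simp add: norm_mult)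
qed

text \<open>Both sides are twice the absolute sine of the angle between the two lines. Squares of
  unit vectors parametrise the projective line, and the Wronskian measures distance on it.\<close>

lemma cmod_diff_squares_unit:
  assumes "cmod z = 1" "cmod w = 1"
  shows "cmod (z\<^sup>2 - w\<^sup>2) = 2 * \<bar>wronskian z w\<bar>"
proof -
  have zw: "z * cnj z = 1" "w * cnj w = 1"
    using assms by (simp_all flip: complex_norm_square)
  have "(z\<^sup>2 - w\<^sup>2) * cnj (z * w) = z * cnj w * (z * cnj z) - w * cnj z * (w * cnj w)"
    by (simp add: power2_eq_square algebra_simps)
  also have "\<dots> = Complex 0 (- 2 * wronskian z w)"
    unfolding zw by (simp add: complex_eq_iff wronskian_def)
  finally have "cmod ((z\<^sup>2 - w\<^sup>2) * cnj (z * w)) = cmod (Complex 0 (- 2 * wronskian z w))"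
    by (rule arg_cong)
  moreover have "cmod (Complex 0 x) = \<bar>x\<bar>" for x
    by (simp add: complex_norm)
  ultimately have "cmod ((z\<^sup>2 - w\<^sup>2) * cnj (z * w)) = \<bar>2 * wronskian z w\<bar>"
    by simp
  then show ?thesis
    using assms by (simp add: norm_mult abs_mult)
qed

lemma wronskian_cis: "wronskian (of_real r * cis \<alpha>) (cis \<beta>) = r * sin (\<beta> - \<alpha>)"
  by (simp add: wronskian_def sin_diff algebra_simps)

lemma continuous_sin_zero_constant:
  fixes f :: "real \<Rightarrow> real"
  assumes "continuous_on UNIV f" "\<And>y. sin (f y) = 0"
  shows "f y = f 0"
proof -
  have "f constant_on UNIV"
  proof (rule continuous_discrete_range_constant[OF connected_UNIV assms(1)])
    fix x :: real
    have "pi \<le> norm (f y - f x)" if "f y \<noteq> f x" for y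
    proof -
      obtain i j where ij: "f y = of_int i * pi" "f x = of_int j * pi"
        using assms(2) sin_zero_iff_int2 by metis
      with that have "1 \<le> \<bar>i - j\<bar>"
        by auto
      then have "1 * pi \<le> of_int \<bar>i - j\<bar> * pi"
        by (intro mult_right_mono) auto
      also have "\<dots> = norm (f y - f x)"
        by (simp add: ij abs_mult flip: left_diff_distrib)
      finally show ?thesis
        by simp
    qed
    then show "\<exists>e>0. \<forall>y. y \<in> UNIV \<and> f y \<noteq> f x \<longrightarrow> e \<le> norm (f y - f x)"
      using pi_gt_zero by blast
  qed
  then show ?thesis
    unfolding constant_on_def by (metis UNIV_I)
qed

locale gap = circle_coeff +
  fixes E D :: real
  assumes E: "4 * a 0 < E" and D: "0 < D" and nb: "no_bump E D"
begin

text \<open>The conserved Wronskian is at most the product of the two norms at each of the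
  \<open>N\<close> times, while \<open>no_bump\<close> bounds the sums of squares by the ends.
  Uniqueness and continuity of the stable direction both follow from this estimate.\<close>

lemma wronskian_bound:
  "real N * \<bar>wronskian z w\<bar> \<le> D * ((cmod z)\<^sup>2 + (cmod w)\<^sup>2
     + (cmod (orb a E y z N))\<^sup>2 + (cmod (orb a E y w N))\<^sup>2)"
proof -
  have "\<bar>wronskian z w\<bar> \<le> (cmod (orb a E y z n))\<^sup>2 + (cmod (orb a E y w n))\<^sup>2" for n
  proof -
    have "\<bar>wronskian z w\<bar> \<le> cmod (orb a E y z n) * cmod (orb a E y w n)"
      using abs_wronskian_le[of "orb a E y z n" "orb a E y w n"] by (simp add: wronskian_orb)
    also have "\<dots> \<le> (cmod (orb a E y z n))\<^sup>2 + (cmod (orb a E y w n))\<^sup>2"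
      using sum_squares_bound[of "cmod (orb a E y z n)" "cmod (orb a E y w n)"]
        mult_nonneg_nonneg[OF norm_ge_zero norm_ge_zero, of "orb a E y z n" "orb a E y w n"]
      by linarith
    finally show ?thesis .
  qed
  then have "(\<Sum>n<N. \<bar>wronskian z w\<bar>)
      \<le> (\<Sum>n<N. (cmod (orb a E y z n))\<^sup>2 + (cmod (orb a E y w n))\<^sup>2)"
    by (intro sum_mono)
  also have "\<dots> \<le> D * ((cmod z)\<^sup>2 + (cmod (orb a E y z N))\<^sup>2)
      + D * ((cmod w)\<^sup>2 + (cmod (orb a E y w N))\<^sup>2)"
    unfolding sum.distrib using nb unfolding no_bump_def by (intro add_mono) auto
  finally show ?thesis
    by (simp add: algebra_simps)
qed

lemma bounded_orbits_parallel:
  assumes "\<And>n. cmod (orb a E y z n) \<le> R" "\<And>n. cmod (orb a E y w n) \<le> S"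
  shows "wronskian z w = 0"
proof -
  have "\<bar>wronskian z w\<bar> = 0"
  proof (rule real_archimedian_rdiv_eq_0)
    fix N :: nat
    have "real N * \<bar>wronskian z w\<bar> \<le> D * ((cmod z)\<^sup>2 + (cmod w)\<^sup>2
        + (cmod (orb a E y z N))\<^sup>2 + (cmod (orb a E y w N))\<^sup>2)"
      by (rule wronskian_bound)
    also have "\<dots> \<le> D * ((cmod z)\<^sup>2 + (cmod w)\<^sup>2 + R\<^sup>2 + S\<^sup>2)"
      using D assms by (intro mult_left_mono add_mono power_mono order_refl) auto
    finally show "real N * \<bar>wronskian z w\<bar> \<le> D * ((cmod z)\<^sup>2 + (cmod w)\<^sup>2 + R\<^sup>2 + S\<^sup>2)" .
  qed (use D in auto)
  then show ?thesis
    by simp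
qed

text \<open>The preimages of \<open>1\<close> and \<open>\<i>\<close> under a map of determinant one
  have Wronskian 1, so one of them has norm at least 1; normalising it gives the vector.\<close>

lemma contracted_vector: "\<exists>z. cmod z = 1 \<and> cmod (orb a E y z N) \<le> 1"
proof -
  have normalize: "\<exists>z. cmod z = 1 \<and> cmod (orb a E y z N) \<le> 1"
    if "1 \<le> cmod v" "cmod (orb a E y v N) = 1" for v
  proof (intro exI conjI)
    let ?z = "of_real (1 / cmod v) * v"
    show "cmod ?z = 1"
      using that by (auto simp: norm_mult norm_divide)
    show "cmod (orb a E y ?z N) \<le> 1"
      unfolding orb_scale using that by (simp add: norm_mult norm_divide divide_le_eq)
  qed
  obtain z w where zw: "orb a E y z N = 1" "orb a E y w N = \<i>"
    using orb_surj by meson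
  have "wronskian z w = 1"
    using wronskian_orb[of E y z N w] by (simp add: zw wronskian_def)
  then have "1 \<le> cmod z * cmod w"
    using abs_wronskian_le[of z w] by simp
  then have "1 \<le> cmod z \<or> 1 \<le> cmod w"
    using mult_strict_mono'[of "cmod z" 1 "cmod w" 1] by force
  then show ?thesis
    using normalize zw by auto
qed

lemma orb_basis:
  "orb a E y z n = of_real (Re z) * orb a E y 1 n + of_real (Im z) * orb a E y \<i> n"
proof -
  have "of_real (Re z) * 1 + of_real (Im z) * \<i> = z"
    by (simp add: complex_eq_iff)
  then show ?thesis
    using orb_linear[of a E y "Re z" 1 "Im z" \<i> n] by metis
qed

text \<open>A limit of unit vectors contracted over longer and longer windows. With both end states
  of norm at most 1, \<open>no_bump\<close> bounds every squared norm in between by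
  \<open>2 * D\<close>, and this survives the limit at each fixed \<open>n\<close>.\<close>

lemma stable_vector: "\<exists>z. cmod z = 1 \<and> (\<forall>n. (cmod (orb a E y z n))\<^sup>2 \<le> 2 * D)"
proof -
  obtain e where e: "\<And>N. cmod (e N) = 1" "\<And>N. cmod (orb a E y (e N) N) \<le> 1"
    using contracted_vector by metis
  have "\<forall>N. e N \<in> sphere 0 1"
    by (simp add: e)
  then obtain l r where l: "l \<in> sphere 0 1" and r: "strict_mono r" "(e \<circ> r) \<longlonglongrightarrow> l"
    using compact_sphere[of "0::complex" 1] unfolding compact_def by metis
  have "(cmod (orb a E y l n))\<^sup>2 \<le> 2 * D" for n
  proof (rule LIMSEQ_le_const2)
    show "(\<lambda>k. (cmod (orb a E y ((e \<circ> r) k) n))\<^sup>2) \<longlonglongrightarrow> (cmod (orb a E y l n))\<^sup>2"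
      unfolding orb_basis[of y "(e \<circ> r) _"] orb_basis[of y l] by (intro tendsto_intros r)
    have "(cmod (orb a E y ((e \<circ> r) k) n))\<^sup>2 \<le> 2 * D" if "k \<ge> Suc n" for k
    proof -
      have n: "n < r k"
        using seq_suble[OF r(1), of k] that by simp
      have "(cmod (orb a E y (e (r k)) n))\<^sup>2 \<le> (\<Sum>m<r k. (cmod (orb a E y (e (r k)) m))\<^sup>2)"
        using n by (intro member_le_sum) auto
      also have "\<dots> \<le> D * ((cmod (e (r k)))\<^sup>2 + (cmod (orb a E y (e (r k)) (r k)))\<^sup>2)"
        using nb unfolding no_bump_def by blast
      also have "\<dots> \<le> D * (1\<^sup>2 + 1\<^sup>2)"
        using D e by (intro mult_left_mono add_mono power_mono) auto
      finally show ?thesis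
        by simp
    qed
    then show "\<exists>K. \<forall>k\<ge>K. (cmod (orb a E y ((e \<circ> r) k) n))\<^sup>2 \<le> 2 * D"
      by blast
  qed
  with l show ?thesis
    by auto
qed

definition stable :: "real \<Rightarrow> complex" where
  "stable y = (SOME z. cmod z = 1 \<and> (\<forall>n. (cmod (orb a E y z n))\<^sup>2 \<le> 2 * D))"

lemma stable_unit: "cmod (stable y) = 1"
  and stable_orb_sq: "(cmod (orb a E y (stable y) n))\<^sup>2 \<le> 2 * D"
  using someI_ex[OF stable_vector[of y]] by (auto simp: stable_def)

lemma stable_orb: "cmod (orb a E y (stable y) n) \<le> sqrt (2 * D)"
  using stable_orb_sq real_le_rsqrt by blast

lemma stable_sq_periodic: "(stable (y + 1))\<^sup>2 = (stable y)\<^sup>2"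
proof -
  have "wronskian (stable (y + 1)) (stable y) = 0"
    using stable_orb[of "y + 1"] stable_orb[of y]
    by (intro bounded_orbits_parallel) (simp_all add: orb_periodic)
  then show ?thesis
    using cmod_diff_squares_unit[OF stable_unit stable_unit, of "y + 1" y] by simp
qed

text \<open>The direction itself has no canonical sign; its square does.\<close>

lemma continuous_stable_sq: "continuous_on UNIV (\<lambda>y. (stable y)\<^sup>2)"
  unfolding continuous_on_iff
proof (intro ballI allI impI)
  fix y0 \<epsilon> :: real
  assume \<epsilon>: "0 < \<epsilon>"
  \<comment> \<open>The four terms of \<open>wronskian_bound\<close> at base \<open>y0\<close> are
    at most 1, 1, \<open>2 + 4 * D\<close> and \<open>2 * D\<close>; the third is the state of
    \<open>stable y\<close> moved over \<open>y0\<close> instead of \<open>y\<close>, an error below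
    1 for \<open>y\<close> near \<open>y0\<close>. The outer factor 2 comes from
    \<open>cmod_diff_squares_unit\<close>.\<close>
  define K where "K = 2 * (D * (4 + 6 * D))"
  obtain N where N: "K / \<epsilon> < real N"
    using reals_Archimedean2 by blast
  define g where "g y = cmod (orb a E y 1 N - orb a E y0 1 N) + cmod (orb a E y \<i> N - orb a E y0 \<i> N)" for y
  have "continuous_on UNIV g"
    unfolding g_def by (intro continuous_intros continuous_orb)
  then obtain d where d: "d > 0" "\<And>y. dist y y0 < d \<Longrightarrow> dist (g y) (g y0) < 1"
    unfolding continuous_on_iff by (metis UNIV_I zero_less_one)
  have "dist ((stable y)\<^sup>2) ((stable y0)\<^sup>2) < \<epsilon>" if "dist y y0 < d" for y
  proof -
    define z where "z = stable y"
    have g: "g y < 1"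
      using d(2)[OF that] by (simp add: g_def)
    have "orb a E y0 z N - orb a E y z N =
        of_real (Re z) * (orb a E y0 1 N - orb a E y 1 N) + of_real (Im z) * (orb a E y0 \<i> N - orb a E y \<i> N)"
      unfolding orb_basis[of y0 z] orb_basis[of y z] by (simp add: algebra_simps)
    also have "cmod \<dots> \<le> \<bar>Re z\<bar> * cmod (orb a E y0 1 N - orb a E y 1 N)
        + \<bar>Im z\<bar> * cmod (orb a E y0 \<i> N - orb a E y \<i> N)"
      by (intro norm_triangle_mono) (simp_all add: norm_mult)
    also have "\<dots> \<le> 1 * cmod (orb a E y0 1 N - orb a E y 1 N) + 1 * cmod (orb a E y0 \<i> N - orb a E y \<i> N)"
      using abs_Re_le_cmod[of z] abs_Im_le_cmod[of z] stable_unit[of y]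
      by (intro add_mono mult_right_mono) (simp_all add: z_def)
    also have "\<dots> = g y"
      by (simp add: g_def norm_minus_commute)
    finally have "cmod (orb a E y0 z N) \<le> 1 + sqrt (2 * D)"
      using g stable_orb[of y N] norm_triangle_sub[of "orb a E y0 z N" "orb a E y z N"]
      by (simp add: z_def)
    then have "(cmod (orb a E y0 z N))\<^sup>2 \<le> (1 + sqrt (2 * D))\<^sup>2"
      by (intro power_mono) auto
    also have "\<dots> \<le> 2 + 4 * D"
      using D sum_squares_bound[of 1 "sqrt (2 * D)"] by (simp add: power2_sum)
    finally have "(cmod z)\<^sup>2 + (cmod (stable y0))\<^sup>2 + (cmod (orb a E y0 z N))\<^sup>2
        + (cmod (orb a E y0 (stable y0) N))\<^sup>2 \<le> 4 + 6 * D"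
      using stable_orb_sq[of y0 N] by (simp add: z_def stable_unit)
    then have "real N * \<bar>wronskian z (stable y0)\<bar> \<le> D * (4 + 6 * D)"
      using wronskian_bound[of N z "stable y0" y0] D
      by (meson less_imp_le mult_left_mono order_trans)
    then have "real N * dist (z\<^sup>2) ((stable y0)\<^sup>2) \<le> K"
      using cmod_diff_squares_unit[of z "stable y0"] by (simp add: z_def stable_unit dist_norm K_def)
    moreover have "K < real N * \<epsilon>"
      using N \<epsilon> by (simp add: field_simps)
    ultimately have "real N * dist (z\<^sup>2) ((stable y0)\<^sup>2) < real N * \<epsilon>"
      by linarith
    then show ?thesis
      by (simp add: z_def mult_less_cancel_left)
  qed
  with d(1) show "\<exists>d>0. \<forall>y\<in>UNIV. dist y y0 < d \<longrightarrow> dist ((stable y)\<^sup>2) ((stable y0)\<^sup>2) < \<epsilon>"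
    by blast
qed

text \<open>On the contractible line the nonvanishing square has a continuous logarithm. Half its
  imaginary part is an angle for \<open>stable y\<close> up to sign, and the sign does not change
  the size of an orbit.\<close>

lemma stable_lift:
  obtains \<theta> where "continuous_on UNIV \<theta>"
    and "\<And>y. cis (2 * \<theta> y) = (stable y)\<^sup>2"
    and "\<And>y n. cmod (orb a E y (cis (\<theta> y)) n) \<le> sqrt (2 * D)"
proof -
  have nz: "(stable y)\<^sup>2 \<noteq> 0" for y
    using stable_unit[of y] by auto
  obtain g where g: "continuous_on UNIV g" "\<And>y::real. (stable y)\<^sup>2 = exp (g y)"
    using continuous_logarithm_on_contractible[OF continuous_stable_sq contractible_UNIV nz] by auto
  define \<theta> where "\<theta> y = Im (g y) / 2" for y
  have sq: "cis (2 * \<theta> y) = (stable y)\<^sup>2" for y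
  proof -
    have "exp (Re (g y)) = cmod ((stable y)\<^sup>2)"
      by (simp add: g)
    then have "Re (g y) = 0"
      by (simp add: norm_power stable_unit)
    then show ?thesis
      unfolding g by (simp add: \<theta>_def exp_eq_polar)
  qed
  have bd: "cmod (orb a E y (cis (\<theta> y)) n) \<le> sqrt (2 * D)" for y n
  proof -
    have "(cis (\<theta> y))\<^sup>2 = (stable y)\<^sup>2"
      using sq[of y] by (simp add: Complex.DeMoivre)
    then consider "cis (\<theta> y) = stable y" | "cis (\<theta> y) = of_real (-1) * stable y"
      by (auto simp: power2_eq_iff)
    then show ?thesis
    proof cases
      case 2
      show ?thesis
        unfolding 2 orb_scale using stable_orb[of y n] by simp
    qed (simp add: stable_orb)
  qed
  have "continuous_on UNIV \<theta>"
    unfolding \<theta>_def by (intro continuous_intros g) auto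
  with sq bd that show ?thesis
    by blast
qed

text \<open>A step never turns a vector by exactly +pi/2 (modulo full turns): the real part of the
  image has the sign of \<open>sin \<tau>\<close>, which forces \<open>sin \<tau> = 0\<close>, but
  real vectors turn by -pi/2. Measured from -pi/2, the turning angle is therefore a principal
  argument that never jumps.\<close>

lemma step_rotation:
  defines "h \<equiv> \<lambda>y \<tau>. \<i> * step a E y (cis \<tau>) * cnj (cis \<tau>)"
  shows "h y \<tau> \<notin> \<real>\<^sub>\<le>\<^sub>0"
    and "step a E y (cis \<tau>) = of_real (cmod (h y \<tau>)) * cis (\<tau> - pi / 2 + Arg (h y \<tau>))"
proof -
  have cc: "cnj (cis \<tau>) * cis \<tau> = 1"
    by (simp add: cis_cnj cis_mult)
  then have ih: "\<i> * step a E y (cis \<tau>) = h y \<tau> * cis \<tau>"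
    by (simp add: h_def mult.assoc)
  show "h y \<tau> \<notin> \<real>\<^sub>\<le>\<^sub>0"
  proof
    assume "h y \<tau> \<in> \<real>\<^sub>\<le>\<^sub>0"
    then obtain r where r: "h y \<tau> = of_real r" "r \<le> 0"
      by (auto elim: nonpos_Reals_cases)
    have re: "sin \<tau> / a y = r * sin \<tau>"
      and im: "- ((E - a y - a (2 * y)) * (sin \<tau> / a y) - a y * cos \<tau>) = r * cos \<tau>"
      using arg_cong[OF ih, of Im] arg_cong[OF ih, of Re] by (simp_all add: r step_def)
    have "(1 / a y - r) * sin \<tau> = 0"
      using re by (simp add: left_diff_distrib)
    moreover have "1 / a y - r > 0"
      using a_pos[of y] r(2) by (smt (verit) divide_pos_pos)
    ultimately have s: "sin \<tau> = 0"
      by simp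
    then have "(a y - r) * cos \<tau> = 0"
      using im by (simp add: left_diff_distrib)
    moreover have "a y - r > 0"
      using a_pos[of y] r(2) by linarith
    ultimately show False
      using s sin_cos_squared_add[of \<tau>] by simp
  qed
  have cis_split: "cis (\<tau> - pi / 2 + \<alpha>) = cis (- (pi / 2)) * cis \<tau> * cis \<alpha>" for \<alpha>
    unfolding cis_mult by (rule arg_cong[of _ _ cis]) simp
  have "step a E y (cis \<tau>) = - \<i> * (h y \<tau> * cis \<tau>)"
    by (simp flip: ih)
  also have "h y \<tau> = of_real (cmod (h y \<tau>)) * cis (Arg (h y \<tau>))"
    by (metis rcis_cmod_Arg rcis_def)
  also have "- \<i> = cis (- (pi / 2))"
    by (simp add: complex_eq_iff)
  finally show "step a E y (cis \<tau>) = of_real (cmod (h y \<tau>)) * cis (\<tau> - pi / 2 + Arg (h y \<tau>))"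
    by (simp add: cis_split mult_ac)
qed

text \<open>At the fixed point \<open>0\<close> the stable solution is \<open>s\<^sub>n = \<mu>\<^sup>n\<close> with \<open>0 < \<mu> < 1\<close>.\<close>

lemma stable_at_fixed_point:
  assumes "\<And>n. cmod (orb a E 0 w n) \<le> R"
  shows "\<exists>\<mu>>0. step a E 0 w = of_real \<mu> * w"
proof -
  define \<alpha> where "\<alpha> = a 0"
  \<comment> \<open>\<open>t\<close> is the trace of the step at 0. It exceeds 2 exactly because
    \<open>E > 4 * a 0\<close>, and \<mu> is the smaller eigenvalue.\<close>
  define t where "t = E / \<alpha> - 2"
  define \<mu> where "\<mu> = (t - sqrt (t\<^sup>2 - 4)) / 2"
  have \<alpha>: "0 < \<alpha>"
    by (simp add: \<alpha>_def a_pos)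
  have t: "2 < t"
    using E \<alpha> by (simp add: t_def \<alpha>_def field_simps)
  have t2: "4 < t\<^sup>2"
    using power_strict_mono[OF t, of 2] by simp
  have root: "\<mu>\<^sup>2 = t * \<mu> - 1"
    using t2 by (simp add: \<mu>_def power2_eq_square field_simps)
  have "sqrt (t\<^sup>2 - 4) < t"
    using t by (intro real_less_lsqrt) auto
  then have \<mu>0: "0 < \<mu>"
    by (simp add: \<mu>_def)
  have \<mu>1: "\<mu> < 1"
  proof (rule ccontr)
    assume "\<not> \<mu> < 1"
    then have "\<mu>\<^sup>2 - t * \<mu> + 1 < 0"
    proof -
      have "sqrt (t\<^sup>2 - 4) \<le> t - 2"
        using \<open>\<not> \<mu> < 1\<close> by (simp add: \<mu>_def)
      then have "t\<^sup>2 - 4 \<le> (t - 2)\<^sup>2"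
        using t2 by (metis real_sqrt_le_iff real_sqrt_unique sqrt_le_D)
      with t show ?thesis
        by (simp add: power2_eq_square algebra_simps)
    qed
    then show False
      using root by simp
  qed
  define v where "v = Complex 1 (\<alpha> * \<mu>)"
  have step_v: "step a E 0 v = of_real \<mu> * v"
  proof -
    have "(E - \<alpha> - \<alpha>) * \<mu> - \<alpha> = \<alpha> * (t * \<mu> - 1)"
      using \<alpha> by (simp add: t_def field_simps)
    then show ?thesis
      using \<alpha> by (simp add: step_def v_def complex_eq_iff power2_eq_square flip: \<alpha>_def root)
  qed
  have "orb a E 0 v n = of_real (\<mu> ^ n) * v" for n
  proof (induction n)
    case (Suc n)
    then show ?case
      using step_linear[of a E 0 "\<mu> ^ n" v 0 0] by (simp add: step_v mult_ac)
  qed simp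
  moreover have "\<mu> ^ n * cmod v \<le> cmod v" for n
    using \<mu>0 \<mu>1 by (intro mult_left_le_one_le) (auto simp: power_le_one)
  ultimately have "cmod (orb a E 0 v n) \<le> cmod v" for n
    using \<mu>0 by (simp add: norm_mult norm_power)
  from bounded_orbits_parallel[OF this assms] have "w = of_real (Re w) * v"
    by (simp add: v_def wronskian_def complex_eq_iff mult.commute)
  then have "step a E 0 w = of_real \<mu> * w"
    using step_linear[of a E 0 "Re w" v 0 0] by (simp add: step_v)
  with \<mu>0 show ?thesis
    by blast
qed

text \<open>
  The degree \<open>d\<close> of the stable direction satisfies \<open>d = 2 * d\<close>, since each step is isotopic to the
  identity while its base point moves by the doubling map. Hence the angle lifts to the circle.
\<close>

lemma stable_angle:
  obtains \<theta> M where "\<And>y. \<bar>\<theta> y\<bar> \<le> M"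
    and "\<And>y. \<exists>\<rho>>0. step a E y (cis (\<theta> y)) = of_real \<rho> * cis (\<theta> (2 * y))"
    and "\<And>y. \<bar>\<theta> (2 * y) - \<theta> y + pi / 2\<bar> < pi"
proof -
  obtain \<theta> where cont_\<theta>: "continuous_on UNIV \<theta>"
    and sq: "\<And>y. cis (2 * \<theta> y) = (stable y)\<^sup>2"
    and bd: "\<And>y n. cmod (orb a E y (cis (\<theta> y)) n) \<le> sqrt (2 * D)"
    using stable_lift by blast
  define h where "h y = \<i> * step a E y (cis (\<theta> y)) * cnj (cis (\<theta> y))" for y
  have h: "h y \<notin> \<real>\<^sub>\<le>\<^sub>0"
    and step_h: "step a E y (cis (\<theta> y)) = of_real (cmod (h y)) * cis (\<theta> y - pi / 2 + Arg (h y))" for y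
    using step_rotation[of y "\<theta> y"] by (simp_all add: h_def)
  have h0: "h y \<noteq> 0" for y
    using h[of y] by auto
  have cont2: "continuous_on UNIV (\<lambda>y. \<theta> (c * y + k))" for c k
    by (rule continuous_on_compose2[OF cont_\<theta>]) (auto intro!: continuous_intros)
  have cont_cis: "continuous_on UNIV (\<lambda>y. cis (\<theta> y))"
    using cont_\<theta> by (intro continuous_intros)
  have cont_h: "continuous_on UNIV h"
    unfolding h_def by (intro continuous_intros continuous_step cont_cis)
  \<comment> \<open>Both angles describe the stable line at \<open>2 * y\<close>, so
    \<open>d\<close> has values in the multiples of pi and is constant. At the fixed point 0 the
    step multiplies the stable vector by a positive number, which makes the constant 0.\<close>
  define d where "d y = \<theta> (2 * y) - (\<theta> y - pi / 2 + Arg (h y))" for y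
  have "sin (d y) = 0" for y
  proof -
    have "cmod (orb a E (2 * y) (step a E y (cis (\<theta> y))) n) \<le> sqrt (2 * D)" for n
      using bd[of y "Suc n"] by (simp only: orb_Suc_shift)
    from bounded_orbits_parallel[OF this bd] have "cmod (h y) * sin (d y) = 0"
      unfolding step_h wronskian_cis d_def .
    then show ?thesis
      using h0 by simp
  qed
  moreover have "continuous_on UNIV d"
  proof -
    have "continuous_on UNIV (\<lambda>y. Arg (h y))"
      by (rule continuous_on_Arg'[OF cont_h h])
    moreover have "continuous_on UNIV (\<lambda>y. \<theta> (2 * y))"
      using cont2[of 2 0] by simp
    ultimately show ?thesis
      unfolding d_def by (intro continuous_on_diff continuous_on_add continuous_on_const cont_\<theta>)
  qed
  ultimately have "d y = d 0" for y
    using continuous_sin_zero_constant[of d] by blast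
  moreover have "d 0 = 0"
  proof -
    obtain \<mu> where \<mu>: "0 < \<mu>" "step a E 0 (cis (\<theta> 0)) = of_real \<mu> * cis (\<theta> 0)"
      using stable_at_fixed_point[OF bd] by blast
    have "h 0 = \<i> * of_real \<mu> * (cis (\<theta> 0) * cnj (cis (\<theta> 0)))"
      by (simp add: h_def \<mu> mult_ac)
    also have "\<dots> = of_real \<mu> * \<i>"
      by (simp add: cis_cnj cis_mult)
    finally have "Arg (h 0) = pi / 2"
      using \<mu>(1) by (simp add: Arg_times_of_real)
    then show ?thesis
      by (simp add: d_def)
  qed
  ultimately have "d y = 0" for y
    by metis
  then have double: "\<theta> (2 * y) = \<theta> y - pi / 2 + Arg (h y)" for y
    by (simp add: d_def)
  define f where "f y = \<theta> (y + 1) - \<theta> y" for y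
  have sin_f: "sin (f y) = 0" for y
  proof -
    have "cis (2 * \<theta> (y + 1)) = cis (2 * \<theta> y)"
      by (simp add: sq stable_sq_periodic)
    then have "cis (2 * \<theta> (y + 1) - 2 * \<theta> y) = 1"
      by (simp flip: cis_divide)
    then have "cos (2 * f y) = 1"
      by (simp add: f_def complex_eq_iff algebra_simps)
    then show ?thesis
      by (simp add: cos_double_sin)
  qed
  have f0: "f y = f 0" for y
  proof (rule continuous_sin_zero_constant[of f, OF _ sin_f])
    show "continuous_on UNIV f"
      unfolding f_def using cont2[of 1 1] by (intro continuous_on_diff cont_\<theta>) simp
  qed
  have "h (y + 1) = h y" for y
  proof -
    have "cis (\<theta> (y + 1)) = cis (f y) * cis (\<theta> y)"
      by (simp add: f_def cis_mult)
    also have "cis (f y) = of_real (cos (f y))"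
      by (simp add: complex_eq_iff sin_f)
    finally have c: "cis (\<theta> (y + 1)) = of_real (cos (f y)) * cis (\<theta> y)" .
    have "(cos (f y))\<^sup>2 = 1"
      using sin_cos_squared_add[of "f y"] sin_f[of y] by simp
    then have "of_real (cos (f y)) * of_real (cos (f y)) = (1 :: complex)"
      by (simp add: power2_eq_square flip: of_real_mult)
    then show ?thesis
      unfolding h_def c step_periodic
      using step_linear[of a E y "cos (f y)" "cis (\<theta> y)" 0 0] by (simp add: algebra_simps)
  qed
  \<comment> \<open>The degree equation: subtracting the angle recursion at 0 from that at 1 gives
    \<open>\<theta> 2 - \<theta> 0 = \<theta> 1 - \<theta> 0\<close>, that is,
    \<open>2 * f 0 = f 0\<close>.\<close>
  from this[of 0] have "f 0 = 0"
    using f0[of 0] f0[of "0 + 1"] double[of 0] double[of 1] unfolding f_def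
    by simp
  then have per_\<theta>: "\<theta> (y + 1) = \<theta> y" for y
    using f0[of y] by (simp add: f_def)
  have "bounded (\<theta> ` {0..1})"
    using cont_\<theta> by (intro compact_imp_bounded compact_continuous_image) (auto intro: continuous_on_subset)
  then obtain M where "\<forall>t\<in>\<theta> ` {0..1}. norm t \<le> M"
    unfolding bounded_iff by blast
  then have M: "\<bar>\<theta> y\<bar> \<le> M" if "y \<in> {0..1}" for y
    using that by simp
  have "\<bar>\<theta> y\<bar> \<le> M" for y
    using M[of "frac y"] periodic_frac[of \<theta>, OF per_\<theta>] frac_lt_1[of y] by simp
  moreover have "\<exists>\<rho>>0. step a E y (cis (\<theta> y)) = of_real \<rho> * cis (\<theta> (2 * y))" for y
    unfolding step_h double using h0[of y] by (intro exI[of _ "cmod (h y)"]) auto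
  moreover have "\<bar>\<theta> (2 * y) - \<theta> y + pi / 2\<bar> < pi" for y
  proof -
    have "Arg (h y) \<noteq> pi"
      using h[of y] Arg_eq_pi[of "h y"] by (auto simp: complex_nonpos_Reals_iff)
    then show ?thesis
      using Arg_le_pi[of "h y"] mpi_less_Arg[of "h y"] by (simp add: double abs_less_iff)
  qed
  ultimately show ?thesis
    using that by blast
qed

end

section \<open>Sign changes and positive solutions\<close>

lemma decreasing_int_eventually_constant:
  fixes k :: "nat \<Rightarrow> int"
  assumes "\<And>n. k (Suc n) \<le> k n" "\<And>n. B \<le> k n"
  shows "\<exists>n0. \<forall>n\<ge>n0. k n = k n0"
proof -
  obtain n0 where n0: "\<And>n. nat (k n0 - B) \<le> nat (k n - B)"
    using ex_has_least_nat[of "\<lambda>_. True" undefined "\<lambda>n. nat (k n - B)"] by auto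
  have "k n = k n0" if "n \<ge> n0" for n
  proof -
    have "k n \<le> k n0"
      using lift_Suc_antimono_le[of k, OF assms(1) that] .
    moreover have "k n0 \<le> k n"
      using n0[of n] assms(2)[of n0] assms(2)[of n] by linarith
    ultimately show ?thesis
      by simp
  qed
  then show ?thesis
    by blast
qed

text \<open>Here \<open>s (Suc n)\<close> is the solution at site \<open>n\<close>, and \<open>s 0\<close> is its value at the missing site \<open>-1\<close>.\<close>

lemma positive_solution_form:
  fixes b s u :: "nat \<Rightarrow> real"
  assumes b: "\<And>n. 0 < b n" and s: "\<And>n. 0 < s n"
    and rec: "\<And>n. b (Suc n) * s (Suc (Suc n)) + b n * s n = (E - b n - b (Suc n)) * s (Suc n)"
    and u: "\<And>n. n \<ge> L \<Longrightarrow> u n = 0"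
  shows "(\<Sum>n\<le>L. b n * (u n - prev u n)\<^sup>2) \<le> E * (\<Sum>n<L. (u n)\<^sup>2)"
proof -
  \<comment> \<open>Young's inequality weighted by the ratio \<open>s n / s (Suc n)\<close> splits
    each squared difference into a part in \<open>u n\<close> and a part in \<open>prev u n\<close>.
    Regrouped by sites, the recurrence makes the coefficient of the square of \<open>u n\<close>
    equal to \<open>E\<close>.\<close>
  define p where "p n = b n * (1 + s n / s (Suc n)) * (u n)\<^sup>2" for n
  define q where "q n = b n * (1 + s (Suc n) / s n) * (prev u n)\<^sup>2" for n
  have le: "b n * (u n - prev u n)\<^sup>2 \<le> p n + q n" for n
  proof -
    define r where "r = s n / s (Suc n)"
    have r: "0 < r" "s (Suc n) / s n = 1 / r"
      using s[of n] s[of "Suc n"] by (simp_all add: r_def)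
    have "0 \<le> r * (u n + prev u n / r)\<^sup>2"
      using r by simp
    also have "\<dots> = r * (u n)\<^sup>2 + 2 * u n * prev u n + (prev u n)\<^sup>2 / r"
      using r by (simp add: power2_eq_square field_simps)
    finally have "(u n - prev u n)\<^sup>2 \<le> (1 + r) * (u n)\<^sup>2 + (1 + 1 / r) * (prev u n)\<^sup>2"
      by (simp add: power2_eq_square algebra_simps)
    then have "b n * (u n - prev u n)\<^sup>2 \<le> b n * ((1 + r) * (u n)\<^sup>2 + (1 + 1 / r) * (prev u n)\<^sup>2)"
      using b[of n] by simp
    then show ?thesis
      by (simp add: p_def q_def r(2) algebra_simps flip: r_def)
  qed
  have "p n + q (Suc n) = E * (u n)\<^sup>2" for n
  proof -
    have "b n * (1 + s n / s (Suc n)) + b (Suc n) * (1 + s (Suc (Suc n)) / s (Suc n)) = E"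
    proof -
      have "b n * (s (Suc n) + s n) + b (Suc n) * (s (Suc n) + s (Suc (Suc n))) = E * s (Suc n)"
        using rec[of n] by (simp add: algebra_simps)
      moreover have "x * (1 + t / s (Suc n)) = x * (s (Suc n) + t) / s (Suc n)" for x t
        using s[of "Suc n"] by (simp add: field_simps)
      ultimately show ?thesis
        using s[of "Suc n"] by (simp flip: add_divide_distrib)
    qed
    then show ?thesis
      by (simp add: p_def q_def prev_def flip: distrib_right)
  qed
  note pq = this
  have "(\<Sum>n\<le>L. b n * (u n - prev u n)\<^sup>2) \<le> (\<Sum>n\<le>L. p n) + (\<Sum>n\<le>L. q n)"
    using le by (simp add: sum_mono flip: sum.distrib)
  also have "(\<Sum>n\<le>L. p n) = (\<Sum>n<L. p n)"
    using u[of L] by (simp add: p_def flip: lessThan_Suc_atMost)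
  also have "(\<Sum>n\<le>L. q n) = (\<Sum>n<L. q (Suc n))"
    by (simp add: sum.atMost_shift q_def prev_def)
  also have "(\<Sum>n<L. p n) + (\<Sum>n<L. q (Suc n)) = E * (\<Sum>n<L. (u n)\<^sup>2)"
    by (simp add: pq sum_distrib_left flip: sum.distrib)
  finally show ?thesis .
qed

context gap
begin

text \<open>
  Crossing the real axis can only lower the integer part of \<open>\<theta> / \<pi>\<close>, so a bounded angle
  crosses it finitely often.
\<close>

lemma floor_angle_step:
  assumes \<rho>: "0 < \<rho>" "step a E y (cis \<tau>) = of_real \<rho> * cis \<tau>'"
    and near: "\<bar>\<tau>' - \<tau> + pi / 2\<bar> < pi"
  shows "\<lfloor>\<tau>' / pi\<rfloor> \<le> \<lfloor>\<tau> / pi\<rfloor>"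
    and "\<lfloor>\<tau>' / pi\<rfloor> = \<lfloor>\<tau> / pi\<rfloor> \<Longrightarrow> 0 < cos (of_int \<lfloor>\<tau> / pi\<rfloor> * pi) * sin \<tau>"
proof -
  define k where "k = \<lfloor>\<tau> / pi\<rfloor>"
  define \<psi> where "\<psi> = \<tau> - of_int k * pi"
  define \<psi>' where "\<psi>' = \<tau>' - of_int k * pi"
  have "of_int k \<le> \<tau> / pi" "\<tau> / pi < of_int k + 1"
    unfolding k_def by linarith+
  then have \<psi>: "0 \<le> \<psi>" "\<psi> < pi"
    by (simp_all add: \<psi>_def field_simps)
  have sk: "sin (of_int k * pi) = 0"
    using sin_zero_iff_int2 by blast
  define c where "c = cos (of_int k * pi)"
  have c2: "c * c = 1"
    using sin_cos_squared_add[of "of_int k * pi"] sk by (simp add: c_def power2_eq_square)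
  have tau: "\<tau> = \<psi> + of_int k * pi" "\<tau>' = \<psi>' + of_int k * pi"
    by (simp_all add: \<psi>_def \<psi>'_def)
  have sin_cos: "sin \<tau> = c * sin \<psi>" "cos \<tau>' = c * cos \<psi>'"
    unfolding tau by (simp_all add: sin_add cos_add sk c_def)
  have "sin \<tau> / a y = \<rho> * cos \<tau>'"
    using arg_cong[OF \<rho>(2), of Re] by (simp add: step_def)
  then have "c * (c * sin \<psi> / a y) = c * (\<rho> * (c * cos \<psi>'))"
    unfolding sin_cos by simp
  \<comment> \<open>This relation excludes two cases: \<open>\<psi>' \<ge> pi\<close>, where the
    cosine would be negative although \<open>sin \<psi>\<close> is not, and
    \<open>\<psi> = 0\<close> with \<open>\<psi>' \<ge> 0\<close>, where it would be positive
    although \<open>sin \<psi>\<close> vanishes.\<close>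
  then have cs: "sin \<psi> / a y = \<rho> * cos \<psi>'"
    using c2 by (simp add: mult.left_commute[of \<rho> c] flip: mult.assoc)
  have range: "- (3 * pi / 2) < \<psi>' - \<psi>" "\<psi>' - \<psi> < pi / 2"
    using near by (simp_all add: \<psi>_def \<psi>'_def abs_less_iff)
  have "\<psi>' < pi"
  proof (rule ccontr)
    assume "\<not> \<psi>' < pi"
    then have "- (pi / 2) < \<psi>' - pi" "\<psi>' - pi < pi / 2"
      using range \<psi> pi_gt_zero by linarith+
    then have "0 < cos (\<psi>' - pi)"
      by (rule cos_gt_zero_pi)
    then have "cos \<psi>' < 0"
      by simp
    then have "\<rho> * cos \<psi>' < 0"
      using \<rho> by (simp add: mult_pos_neg)
    moreover have "0 \<le> sin \<psi> / a y"
      using \<psi> a_pos[of y] by (intro divide_nonneg_pos sin_ge_zero) auto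
    ultimately show False
      using cs by linarith
  qed
  then have "\<tau>' / pi < of_int k + 1"
    by (simp add: \<psi>'_def field_simps)
  then show "\<lfloor>\<tau>' / pi\<rfloor> \<le> \<lfloor>\<tau> / pi\<rfloor>"
    unfolding k_def[symmetric] by linarith
  assume "\<lfloor>\<tau>' / pi\<rfloor> = \<lfloor>\<tau> / pi\<rfloor>"
  then have "of_int k \<le> \<tau>' / pi"
    unfolding k_def by linarith
  then have \<psi>'0: "0 \<le> \<psi>'"
    by (simp add: \<psi>'_def field_simps)
  have "\<psi> \<noteq> 0"
  proof
    assume "\<psi> = 0"
    with range \<psi>'0 have "0 < cos \<psi>'"
      by (intro cos_gt_zero_pi) auto
    then have "0 < \<rho> * cos \<psi>'"
      using \<rho> by simp
    then show False
      using cs \<open>\<psi> = 0\<close> by auto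
  qed
  then have "0 < sin \<psi>"
    using \<psi> by (intro sin_gt_zero) auto
  moreover have "cos (of_int \<lfloor>\<tau> / pi\<rfloor> * pi) * sin \<tau> = sin \<psi>"
    unfolding sin_cos k_def[symmetric] c_def[symmetric] using c2 by (simp flip: mult.assoc)
  ultimately show "0 < cos (of_int \<lfloor>\<tau> / pi\<rfloor> * pi) * sin \<tau>"
    by simp
qed

text \<open>The floor of angle over pi is nonincreasing and bounded below, so it freezes, and
  \<sigma> is the sign of the sine from then on. The sine gives the imaginary part of a state, hence
  the sign of the next solution value; this shifts the threshold by one.\<close>

lemma eventually_positive_solution:
  "\<exists>z \<sigma> n0. \<forall>n\<ge>n0. 0 < \<sigma> * Re (orb a E y z n)"
proof -
  obtain \<theta> M where M: "\<And>y. \<bar>\<theta> y\<bar> \<le> M"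
    and st: "\<And>y. \<exists>\<rho>>0. step a E y (cis (\<theta> y)) = of_real \<rho> * cis (\<theta> (2 * y))"
    and near: "\<And>y. \<bar>\<theta> (2 * y) - \<theta> y + pi / 2\<bar> < pi"
    using stable_angle by blast
  define t where "t n = \<theta> (2 ^ n * y)" for n
  have t_step: "\<exists>\<rho>>0. step a E (2 ^ n * y) (cis (t n)) = of_real \<rho> * cis (t (Suc n))"
    and t_near: "\<bar>t (Suc n) - t n + pi / 2\<bar> < pi" for n
    using st[of "2 ^ n * y"] near[of "2 ^ n * y"] by (simp_all add: t_def mult.assoc)
  define k where "k n = \<lfloor>t n / pi\<rfloor>" for n
  have "k (Suc n) \<le> k n" for n
    using t_step[of n] floor_angle_step(1)[OF _ _ t_near] unfolding k_def by blast
  moreover have "\<lfloor>- M / pi\<rfloor> \<le> k n" for n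
    unfolding k_def using M[of "2 ^ n * y"]
    by (intro floor_mono divide_right_mono) (auto simp: t_def abs_le_iff)
  ultimately obtain n0 where n0: "\<And>n. n \<ge> n0 \<Longrightarrow> k n = k n0"
    using decreasing_int_eventually_constant by metis
  define \<sigma> where "\<sigma> = cos (of_int (k n0) * pi)"
  have pos: "0 < \<sigma> * sin (t n)" if "n \<ge> n0" for n
  proof -
    have "k (Suc n) = k n" "k n = k n0"
      using n0[of n] n0[of "Suc n"] that by simp_all
    then show ?thesis
      using t_step[of n] floor_angle_step(2)[OF _ _ t_near] unfolding k_def \<sigma>_def by metis
  qed
  have orb: "\<exists>\<rho>>0. orb a E y (cis (t 0)) n = of_real \<rho> * cis (t n)" for n
  proof (induction n)
    case 0
    show ?case
      by (intro exI[of _ 1]) simp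
  next
    case (Suc n)
    obtain \<rho> \<rho>' where "0 < \<rho>" "orb a E y (cis (t 0)) n = of_real \<rho> * cis (t n)"
      "0 < \<rho>'" "step a E (2 ^ n * y) (cis (t n)) = of_real \<rho>' * cis (t (Suc n))"
      using Suc t_step by blast
    then show ?case
      using step_linear[of a E "2 ^ n * y" \<rho> "cis (t n)" 0 0]
      by (intro exI[of _ "\<rho> * \<rho>'"]) simp
  qed
  have "0 < \<sigma> * Re (orb a E y (cis (t 0)) n)" if "n \<ge> Suc n0" for n
  proof -
    from that obtain m where m: "n = Suc m" "m \<ge> n0"
      by (cases n) auto
    obtain \<rho> where \<rho>: "0 < \<rho>" "orb a E y (cis (t 0)) m = of_real \<rho> * cis (t m)"
      using orb by blast
    have "0 < \<rho> * (\<sigma> * sin (t m))"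
      using \<rho> pos[OF m(2)] by simp
    also have "\<dots> = \<sigma> * Im (orb a E y (cis (t 0)) m)"
      by (simp add: \<rho>)
    also have "\<dots> = cf y m * (\<sigma> * Re (orb a E y (cis (t 0)) n))"
      by (simp only: Im_orb m mult.left_commute)
    finally show ?thesis
      using cf_pos[of y m] by (simp add: zero_less_mult_iff)
  qed
  then show ?thesis
    by blast
qed

text \<open>Positivity holds only on a tail, but a tail of a dense orbit is still dense, and for
  fixed \<open>u\<close> the form inequality is a closed condition on the base point.\<close>

lemma below_form_gap:
  assumes "dense_orbit x"
  shows "below_form E"
  unfolding below_form_def
proof (intro allI impI)
  fix y :: real and L :: nat and u :: "nat \<Rightarrow> real"
  assume u: "\<forall>n\<ge>L. u n = 0"
  define G where "G y = (\<Sum>n\<le>L. cf y n * (u n - prev u n)\<^sup>2) - E * (\<Sum>n<L. (u n)\<^sup>2)" for y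
  obtain z \<sigma> n0 where pos: "\<And>n. n \<ge> n0 \<Longrightarrow> 0 < \<sigma> * Re (orb a E x z n)"
    using eventually_positive_solution by blast
  have "G (2 ^ k * x) \<le> 0" if "k \<ge> n0" for k
  proof -
    define s where "s n = \<sigma> * Re (orb a E x z (k + n))" for n
    have "cf (2 ^ k * x) (Suc n) * s (Suc (Suc n)) + cf (2 ^ k * x) n * s n
        = (E - cf (2 ^ k * x) n - cf (2 ^ k * x) (Suc n)) * s (Suc n)" for n
    proof -
      have "\<sigma> * (cf x (Suc (k + n)) * Re (orb a E x z (Suc (Suc (k + n)))) + cf x (k + n) * Re (orb a E x z (k + n)))
          = \<sigma> * ((E - cf x (k + n) - cf x (Suc (k + n))) * Re (orb a E x z (Suc (k + n))))"
        by (simp only: orb_recurrence)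
      then show ?thesis
        unfolding s_def cf_add[symmetric] by (simp add: algebra_simps del: orb.simps)
    qed
    then show ?thesis
      unfolding G_def using positive_solution_form[of "cf (2 ^ k * x)" s E L u] u pos that
      by (simp add: s_def cf_pos)
  qed
  moreover have "continuous_on UNIV G"
    unfolding G_def by (intro continuous_intros continuous_cf)
  moreover have "G (y + 1) = G y" for y
    by (simp add: G_def cf_periodic)
  ultimately have "G y \<le> 0"
    using dense_orbit_positive[OF assms, of G y n0] by (meson not_le)
  then show "(\<Sum>n\<le>L. cf y n * (u n - prev u n)\<^sup>2) \<le> E * (\<Sum>n<L. (u n)\<^sup>2)"
    by (simp add: G_def)
qed

end

section \<open>The spectrum along a dense orbit\<close>

lemma AE_circle_measure_ex:
  assumes "AE x in circle_measure. P x"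
  shows "\<exists>x. P x"
proof (rule ccontr)
  assume "\<not> (\<exists>x. P x)"
  with assms have "AE x in circle_measure. False"
    by simp
  then show False
    by (simp add: circle_measure_def eventually_False ae_filter_eq_bot_iff
        emeasure_restrict_space space_restrict_space)
qed

context circle_coeff
begin

text \<open>The \<open>A\<close> of the overview, taken as the least admissible upper bound instead
  of a supremum of quotients.\<close>

definition form_bound :: real where
  "form_bound = Inf {B. 0 \<le> B \<and> below_form B}"

lemma below_form_hi: "below_form (4 * hi)"
  unfolding below_form_def
proof (intro allI impI)
  fix y :: real and L :: nat and u :: "nat \<Rightarrow> real"
  assume u: "\<forall>n\<ge>L. u n = 0"
  have "(\<Sum>n\<le>L. cf y n * (u n - prev u n)\<^sup>2) \<le> (\<Sum>n\<le>L. 2 * hi * (u n)\<^sup>2 + 2 * hi * (prev u n)\<^sup>2)"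
  proof (rule sum_mono)
    fix n
    have "0 \<le> (u n + prev u n)\<^sup>2"
      by simp
    then have "(u n - prev u n)\<^sup>2 \<le> 2 * (u n)\<^sup>2 + 2 * (prev u n)\<^sup>2"
      by (simp add: power2_eq_square algebra_simps)
    then have "cf y n * (u n - prev u n)\<^sup>2 \<le> hi * (2 * (u n)\<^sup>2 + 2 * (prev u n)\<^sup>2)"
      using hi_pos by (intro mult_mono) (auto simp: cf_def hi)
    then show "cf y n * (u n - prev u n)\<^sup>2 \<le> 2 * hi * (u n)\<^sup>2 + 2 * hi * (prev u n)\<^sup>2"
      by (simp add: algebra_simps)
  qed
  also have "\<dots> = 2 * hi * (\<Sum>n\<le>L. (u n)\<^sup>2) + 2 * hi * (\<Sum>n\<le>L. (prev u n)\<^sup>2)"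
    by (simp add: sum.distrib sum_distrib_left)
  also have "(\<Sum>n\<le>L. (u n)\<^sup>2) = (\<Sum>n<L. (u n)\<^sup>2)"
    using u by (simp flip: lessThan_Suc_atMost)
  also have "(\<Sum>n\<le>L. (prev u n)\<^sup>2) = (\<Sum>n<L. (u n)\<^sup>2)"
    by (simp add: sum.atMost_shift prev_def)
  finally show "(\<Sum>n\<le>L. cf y n * (u n - prev u n)\<^sup>2) \<le> 4 * hi * (\<Sum>n<L. (u n)\<^sup>2)"
    by simp
qed

lemma form_bound_le: "0 \<le> B \<Longrightarrow> below_form B \<Longrightarrow> form_bound \<le> B"
  unfolding form_bound_def by (intro cInf_lower bdd_belowI[of _ 0]) auto

lemma below_form_bound: "below_form form_bound"
  unfolding below_form_def
proof (intro allI impI)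
  fix y :: real and L :: nat and u :: "nat \<Rightarrow> real"
  assume u: "\<forall>n\<ge>L. u n = 0"
  define Q where "Q = (\<Sum>n\<le>L. cf y n * (u n - prev u n)\<^sup>2)"
  define S where "S = (\<Sum>n<L. (u n)\<^sup>2)"
  have QB: "Q \<le> B * S" if "below_form B" for B
    using that u unfolding below_form_def Q_def S_def by blast
  have S: "0 \<le> S"
    by (simp add: S_def sum_nonneg)
  have "Q \<le> form_bound * S"
  proof (cases "S = 0")
    case True
    then show ?thesis
      using QB[OF below_form_hi] by simp
  next
    case False
    have "Q / S \<le> form_bound"
      unfolding form_bound_def
    proof (rule cInf_greatest)
      show "{B. 0 \<le> B \<and> below_form B} \<noteq> {}"
        using below_form_hi hi_pos by (auto intro!: exI[of _ "4 * hi"])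
      show "Q / S \<le> B" if "B \<in> {B. 0 \<le> B \<and> below_form B}" for B
        using QB[of B] that S False by (simp add: field_simps)
    qed
    then show ?thesis
      using S False by (simp add: field_simps)
  qed
  then show "(\<Sum>n\<le>L. cf y n * (u n - prev u n)\<^sup>2) \<le> form_bound * (\<Sum>n<L. (u n)\<^sup>2)"
    by (simp add: Q_def S_def)
qed

lemma form_bound_pos: "0 < form_bound"
proof -
  define u where "u n = (if n = 0 then 1 else 0 :: real)" for n :: nat
  have "(\<Sum>n\<le>1. cf 0 n * (u n - prev u n)\<^sup>2) \<le> form_bound * (\<Sum>n<1. (u n)\<^sup>2)"
    using below_form_bound[unfolded below_form_def, rule_format, of 1 u 0] by (simp add: u_def)
  then show ?thesis
    using cf_pos[of 0 0] cf_pos[of 0 1] by (simp add: u_def prev_def)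
qed

lemma outside_resolvent_set:
  assumes "z \<notin> complex_of_real ` {0..form_bound}"
  shows "z \<in> resolvent_set (jacobi_op a x)"
proof (rule jacobi_op_resolvent_set[OF _ form_bound_pos _ assms])
  show "0 \<le> doubling_coeff a x n" for n
    by (simp add: doubling_coeff_eq_cf less_imp_le cf_pos)
  show "(\<Sum>n\<le>L. doubling_coeff a x n * (v n - prev v n)\<^sup>2) \<le> form_bound * (\<Sum>n<L. (v n)\<^sup>2)"
    if "\<And>n. n \<ge> L \<Longrightarrow> v n = 0" for L and v :: "nat \<Rightarrow> real"
    using below_form_bound that unfolding below_form_def doubling_coeff_eq_cf by blast
qed

lemma not_bounded_below:
  assumes x: "dense_orbit x" and rng: "0 \<le> E" "E \<le> 4 * a 0 \<or> E < form_bound"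
  shows "\<exists>u\<in>l2. C * l2_norm (shift_op (jacobi_op a x) (complex_of_real E) u) < l2_norm u"
proof (rule ccontr)
  assume "\<not> ?thesis"
  then have "jac_bounded_below E C"
    by (intro jac_bounded_below_transfer[OF x]) (simp add: not_less)
  then obtain D where D: "0 < D" "no_bump E D"
    using no_bumpI by blast
  then have E4: "4 * a 0 < E"
    using no_bump_plane_wave[OF rng(1) _ D(1)] by linarith
  then interpret gap a lo hi E D
    using D by unfold_locales
  have "form_bound \<le> E"
    using form_bound_le[OF rng(1)] below_form_gap[OF x] by blast
  then show False
    using rng E4 by linarith
qed

text \<open>\<open>not_bounded_below\<close> excludes \<open>E = form_bound\<close> when this
  exceeds \<open>4 * a 0\<close>. A lower bound with constant \<open>C\<close> at \<open>E\<close>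
  persists with \<open>2 * C\<close> at any \<open>E'\<close> within \<open>1 / (2 * C)\<close> of
  \<open>E\<close>, so the endpoint is handled by moving slightly down; the cap
  \<open>form_bound / 2\<close> keeps \<open>E'\<close> nonnegative.\<close>

lemma mem_spectrum:
  assumes x: "dense_orbit x" and E: "0 \<le> E" "E \<le> 4 * a 0 \<or> E \<le> form_bound"
  shows "complex_of_real E \<in> spectrum (jacobi_op a x)"
proof (rule ccontr)
  define S where "S = (\<lambda>E. shift_op (jacobi_op a x) (complex_of_real E))"
  assume "complex_of_real E \<notin> spectrum (jacobi_op a x)"
  then obtain C0 where bij: "bij_betw (S E) l2 l2" and C0: "\<And>u. u \<in> l2 \<Longrightarrow> l2_norm u \<le> C0 * l2_norm (S E u)"
    by (auto simp: spectrum_def resolvent_set_def S_def)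
  define C where "C = max C0 1"
  have mem: "S E u \<in> l2" if "u \<in> l2" for u
    using bij that by (auto simp: bij_betw_def)
  have C: "l2_norm u \<le> C * l2_norm (S E u)" if "u \<in> l2" for u
    using C0[OF that] mult_right_mono[of C0 C "l2_norm (S E u)"] l2_norm_nonneg[OF mem[OF that]]
    by (simp add: C_def)
  have C1: "1 \<le> C"
    by (simp add: C_def)
  define \<delta> where "\<delta> = min (1 / (2 * C)) (form_bound / 2)"
  have \<delta>: "0 < \<delta>" "C * \<delta> \<le> 1 / 2"
    using C1 form_bound_pos by (auto simp: \<delta>_def min_def field_simps)
  define E' where "E' = (if E \<le> 4 * a 0 \<or> E < form_bound then E else E - \<delta>)"
  have E': "0 \<le> E'" "E' \<le> 4 * a 0 \<or> E' < form_bound" "\<bar>E - E'\<bar> \<le> \<delta>"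
    using E \<delta> form_bound_pos by (auto simp: E'_def \<delta>_def min_def)
  have "l2_norm u \<le> 2 * C * l2_norm (S E' u)" if u: "u \<in> l2" for u
  proof -
    define w where "w = (\<lambda>n. complex_of_real (E' - E) * u n)"
    have w: "w \<in> l2" "l2_norm w \<le> \<delta> * l2_norm u"
    proof -
      have "w \<in> l2 \<and> l2_norm w \<le> \<bar>E' - E\<bar> * l2_norm u"
        unfolding w_def using l2_scale[OF u, of "complex_of_real (E' - E)"] by (simp only: norm_of_real)
      moreover have "\<bar>E' - E\<bar> * l2_norm u \<le> \<delta> * l2_norm u"
        using E'(3) l2_norm_nonneg[OF u] by (intro mult_right_mono) auto
      ultimately show "w \<in> l2" "l2_norm w \<le> \<delta> * l2_norm u"
        by auto
    qed
    have "S E' u = (\<lambda>n. S E u n - w n)"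
      by (simp add: S_def shift_op_def w_def fun_eq_iff algebra_simps)
    then have m: "S E' u \<in> l2"
      using l2_diff[OF mem[OF u] w(1)] by simp
    have "S E u = (\<lambda>n. S E' u n + w n)"
      by (simp add: S_def shift_op_def w_def fun_eq_iff algebra_simps)
    then have "l2_norm (S E u) \<le> l2_norm (S E' u) + \<delta> * l2_norm u"
      using l2_add[OF m w(1)] w(2) by simp
    then have "C * l2_norm (S E u) \<le> C * l2_norm (S E' u) + (C * \<delta>) * l2_norm u"
      using C1 mult_left_mono[of "l2_norm (S E u)" "l2_norm (S E' u) + \<delta> * l2_norm u" C]
      by (simp add: algebra_simps)
    moreover have "(C * \<delta>) * l2_norm u \<le> 1 / 2 * l2_norm u"
      using \<delta> l2_norm_nonneg[OF u] by (intro mult_right_mono)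
    ultimately show ?thesis
      using C[OF u] by simp
  qed
  then show False
    using not_bounded_below[OF x E'(1,2), of "2 * C"] by (auto simp: S_def not_less[symmetric])
qed

lemma spectrum_dense_orbit:
  assumes "dense_orbit x"
  shows "spectrum (jacobi_op a x) = complex_of_real ` {0..form_bound}"
proof
  show "spectrum (jacobi_op a x) \<subseteq> complex_of_real ` {0..form_bound}"
    using outside_resolvent_set by (auto simp: spectrum_def)
  show "complex_of_real ` {0..form_bound} \<subseteq> spectrum (jacobi_op a x)"
    using mem_spectrum[OF assms] by auto
qed

text \<open>As \<open>form_bound\<close> is positive, the spectrum is a nondegenerate interval. It
  has no isolated points, so the discrete spectrum is empty whatever the eigenspaces are.\<close>

lemma ess_spectrum_dense_orbit:
  assumes "dense_orbit x"
  shows "ess_spectrum (jacobi_op a x) = complex_of_real ` {0..form_bound}"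
proof -
  have "\<not> z isolated_in complex_of_real ` {0..form_bound}" for z
  proof
    assume "z isolated_in complex_of_real ` {0..form_bound}"
    then obtain t e where t: "z = complex_of_real t" "t \<in> {0..form_bound}" and e: "0 < e"
      "\<And>s. s \<in> {0..form_bound} \<Longrightarrow> dist z (complex_of_real s) < e \<Longrightarrow> complex_of_real s = z"
      unfolding isolated_in_dist_Ex_iff by auto
    define d where "d = min (e / 2) (form_bound / 2)"
    define s where "s = (if t \<le> form_bound / 2 then t + d else t - d)"
    have d: "0 < d" "d < e" "d \<le> form_bound / 2"
      using e form_bound_pos by (auto simp: d_def)
    have "s \<in> {0..form_bound}" "\<bar>t - s\<bar> = d" "s \<noteq> t"
      using t d by (auto simp: s_def)
    then show False
      using e(2)[of s] d by (simp add: t dist_norm flip: of_real_diff)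
  qed
  then show ?thesis
    by (simp add: ess_spectrum_def discrete_spectrum_def spectrum_dense_orbit[OF assms])
qed

end

theorem theorem1p1:
  fixes a :: "real \<Rightarrow> real"
  assumes "continuous_on UNIV a"
    and "\<And>x. a (x + 1) = a x"
    and "0 < (INF x. a x)"
    and "(INF x. a x) < (SUP x. a x)"
  shows "(AE x in circle_measure.
            ess_spectrum (jacobi_op a x) = complex_of_real ` Sigma_ess a) \<and>
         (\<exists>A>0. {0..4 * a 0} \<subseteq> Sigma_ess a \<and> Sigma_ess a = {0..A} \<and>
            {0..A} \<subseteq> {0..4 * (SUP x. a x)})"
proof -
  have "compact (a ` {0..1})"
    using assms(1) by (intro compact_continuous_image) (auto intro: continuous_on_subset)
  moreover have "range a = a ` {0..1}"
  proof (intro subset_antisym image_subsetI)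
    fix x :: real
    have "frac x \<in> {0..1}"
      using frac_lt_1[of x] by simp
    then have "a (frac x) \<in> a ` {0..1}"
      by (rule imageI)
    then show "a x \<in> a ` {0..1}"
      by (simp only: periodic_frac[of a, OF assms(2)])
  qed auto
  ultimately have "bounded (range a)"
    by (simp add: compact_imp_bounded)
  then interpret circle_coeff a "INF x. a x" "SUP x. a x"
    using assms by unfold_locales
      (auto intro: cINF_lower cSUP_upper bounded_imp_bdd_below bounded_imp_bdd_above)
  have ess: "AE x in circle_measure. ess_spectrum (jacobi_op a x) = complex_of_real ` {0..form_bound}"
    using AE_dense_orbit by eventually_elim (rule ess_spectrum_dense_orbit)
  then have \<Sigma>: "Sigma_ess a = {0..form_bound}"
    by (rule Sigma_ess_eqI)
  obtain x where "dense_orbit x"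
    using AE_circle_measure_ex[OF AE_dense_orbit] by blast
  \<comment> \<open>Plane waves at 0 put \<open>4 * a 0\<close> into the spectrum; since the
    spectrum ends at \<open>form_bound\<close>, the inequality between the two numbers
    follows.\<close>
  then have "complex_of_real (4 * a 0) \<in> complex_of_real ` {0..form_bound}"
    using mem_spectrum[of x "4 * a 0"] a_pos[of 0] by (simp add: spectrum_dense_orbit)
  then have "4 * a 0 \<le> form_bound"
    by (auto simp del: of_real_mult)
  moreover have "form_bound \<le> 4 * (SUP x. a x)"
    using hi_pos by (intro form_bound_le below_form_hi) simp
  ultimately show ?thesis
    unfolding \<Sigma> using ess form_bound_pos by (intro conjI exI[of _ form_bound]) auto
qed

end
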